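(* Let $r\geq 2$ be an integer, let $0<b<2^{-10}r^{-6}$, let $n\geq r^{20}$, and let $G$ be a graph of order $n$. If $\mu(G)>(1-1/r-b)n$, then $G$ satisfies at least one of the following: (a) $js_{r+1}(G)>n^{r-1}/r^{2r+5}$; (b) $G$ contains an induced subgraph $G_0$ which is $r$-partite, has at least $(1-4b^{1/3})n$ vertices, and has minimum degree $\delta(G_0)>(1-1/r-7b^{1/3})n$.
   Context: All graphs are finite and simple. For a graph $G$, $\mu(G)$ denotes the largest eigenvalue of the adjacency matrix of $G$, and $\delta(G)$ its minimum degree. A graph is $r$-partite if its vertex set can be partitioned into $r$ independent sets. For an integer $k\ge 2$, a $k$-joint of size $t$ is the union of $t$ distinct $k$-cliques all sharing a common edge; $js_k(G)$ denotes the maximum size of a $k$-joint contained in $G$. *)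

theory Defs
  imports
    "HOL-Analysis.Analysis"
    "Jordan_Normal_Form.Spectral_Radius"
    "Graph_Theory.Graph_Theory"
begin

text \<open>
  A finite simple graph is a record satisfying the predicate \<^const>\<open>graph\<close>: a finite, loop-free,
  symmetric digraph without parallel arcs. An undirected edge is a pair of opposite arcs, so the
  degree of a vertex is its \<^const>\<open>out_degree\<close>.
\<close>

text \<open>
  A different enumeration of the vertices conjugates the matrix by a permutation matrix and
  leaves its spectrum unchanged.
\<close>

definition adjacency_matrix :: "('a, 'b) pre_digraph \<Rightarrow> real mat" where
  "adjacency_matrix G =
     (let vs = (SOME vs. distinct vs \<and> set vs = verts G)
      in mat (length vs) (length vs)
           (\<lambda>(i, j). if (vs ! i, vs ! j) \<in> arcs_ends G then 1 else 0))"

definition graph_index :: "('a, 'b) pre_digraph \<Rightarrow> real" where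
  "graph_index G = Max (spectrum (adjacency_matrix G))"

definition min_degree :: "('a, 'b) pre_digraph \<Rightarrow> nat" where
  "min_degree G = Min (out_degree G ` verts G)"

definition independent_in :: "('a, 'b) pre_digraph \<Rightarrow> 'a set \<Rightarrow> bool" where
  "independent_in G S \<longleftrightarrow> S \<subseteq> verts G \<and> (\<forall>u\<in>S. \<forall>v\<in>S. (u, v) \<notin> arcs_ends G)"

text \<open>Parts are allowed to be empty.\<close>

definition multipartite :: "nat \<Rightarrow> ('a, 'b) pre_digraph \<Rightarrow> bool" where
  "multipartite r G \<longleftrightarrow>
     (\<exists>P :: nat \<Rightarrow> 'a set. disjoint_family_on P {..<r} \<and> (\<Union>i<r. P i) = verts G \<and>
        (\<forall>i<r. independent_in G (P i)))"

text \<open>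
  The cliques in \<open>C\<close> are subgraphs of \<open>J\<close>, hence they share its \<^const>\<open>tail\<close> and \<^const>\<open>head\<close>
  maps and are distinct records iff they are distinct as subgraphs. The empty graph is the only
  joint of size 0.
\<close>

definition is_joint :: "nat \<Rightarrow> nat \<Rightarrow> ('a, 'b) pre_digraph \<Rightarrow> bool" where
  "is_joint k t J \<longleftrightarrow> graph J \<and>
     (\<exists>C. finite C \<and> card C = t \<and>
        (\<forall>H\<in>C. subgraph H J \<and> complete_digraph k H) \<and>
        (\<exists>e. \<forall>H\<in>C. e \<in> arcs H) \<and>
        verts J = (\<Union>H\<in>C. verts H) \<and> arcs J = (\<Union>H\<in>C. arcs H))"

definition joint_size :: "nat \<Rightarrow> ('a, 'b) pre_digraph \<Rightarrow> nat" where
  "joint_size k G = Max {t. \<exists>J. subgraph J G \<and> is_joint k t J}"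

end

theory Submission
  imports Defs
begin

text \<open>
  Write \<open>a = 1 - 1/r\<close> and suppose that every edge lies in at most \<open>n\<^sup>r\<^sup>-\<^sup>1 / r\<^sup>2\<^sup>r\<^sup>+\<^sup>5\<close> cliques of order \<open>r + 1\<close>.
  A weighted Moon--Moser inequality bounds \<open>\<Sum>\<^sub>u\<^sub>\<sim>\<^sub>v y u y v\<close> for probability weights \<open>y\<close>; applied to the
  uniform weights and to the squared entries of a Perron vector it shows, by Cauchy--Schwarz, that
  \<open>\<mu> / m\<close> cannot exceed \<open>a\<close> by a constant on any induced subgraph of order \<open>m \<ge> n / 2\<close>.
  As long as some degree is at most \<open>(a - 1 / (2 r\<^sup>4)) m\<close>, deleting the vertex with the smallest Perron
  entry increases \<open>\<mu> / m\<close> by at least a constant times \<open>1 / n\<close>. Hence the deletion stops early, at a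
  subgraph \<open>H\<close> of large minimum degree.

  In a graph of large minimum degree, an \<open>(r + 1)\<close>-clique contains an edge whose codegree exceeds
  \<open>(1 - 2/r) m\<close> by a constant fraction of \<open>m\<close>, and this edge lies in too many \<open>(r + 1)\<close>-cliques. So \<open>H\<close> has no such
  clique, which bounds the number of deleted vertices in terms of \<open>b\<close> and, together with the minimum
  degree, makes \<open>H\<close> \<open>r\<close>-partite. As \<open>\<mu>\<^sup>2 \<le> 2 e(H) a\<close>, only \<open>O(b m\<^sup>2)\<close> pairs between the parts are missing, so
  few vertices of \<open>H\<close> have small degree, and removing them gives \<open>G\<^sub>0\<close>.
\<close>

section \<open>Real inequalities\<close>

text \<open>The bound on cliques per edge cannot by itself give a sharp eigenvalue bound: its error
  is of order \<open>1 / r^4\<close> and does not shrink with \<open>b\<close>. This crude bound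
  serves only to stop the deletion before half of the vertices are gone. With large minimum degree,
  one \<open>(r + 1)\<close>-clique would already force too many, so there is none; the error term
  disappears, and all remaining losses are measured in \<open>b\<close>. The constants fit this
  scheme. The degree defect \<open>1 / (2 r^4)\<close> keeps the loss in the clique count below the
  codegree surplus \<open>2 / (r^2 (r + 1))\<close>. One deletion gains
  \<open>7 / (20 r^4 n)\<close>, so \<open>n / 2\<close> deletions would gain
  \<open>7 / (40 r^4)\<close>, more than the crude error \<open>5 / (32 r^4)\<close> with room for
  \<open>b\<close>. The cube root balances the final cleaning: for \<open>b = \<beta>^3\<close>, a
  deficit of \<open>2 \<beta>^3 m^2\<close> in the degree sum moves no part size up by more than
  \<open>\<beta> m / 2\<close>, and at most \<open>\<beta> n / 100\<close> vertices can have low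
  degree.\<close>

lemma real_binomial_Suc:
  assumes "s \<le> q"
  shows "real (Suc s) * real (q choose Suc s) = (real q - real s) * real (q choose s)"
  by (metis assms of_nat_diff of_nat_mult binomial_absorption Suc_times_binomial_eq Suc_diff_le binomial_absorb_comp)

text \<open>\<open>X\<close> is the squared smallest Perron entry and \<open>l'\<close> the
  eigenvalue after the deletion. For constant vectors \<open>m * X = 1\<close>, and
  \<open>l / m\<close> would not change to first order. The hypothesis \<open>small\<close> pushes
  \<open>m * X\<close> below \<open>1\<close> by a constant multiple of \<open>e\<close>, and this
  deficit is the gain.\<close>

lemma deletion_gain_arith:
  fixes m l l' X a b e :: real
  assumes e: "0 < e" "e \<le> 1 / 32" and b: "0 \<le> b" "b \<le> e / 20" and a: "1 / 2 \<le> a" "a \<le> 1"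
    and m: "m * e \<ge> 4" "m > 1" and l: "l \<ge> (a - b) * m" and X: "0 \<le> X" "m * X \<le> 1"
    and small: "X * (l\<^sup>2 + (a - e) * m * (m - (a - e) * m)) \<le> (a - e) * m"
    and l': "l * (1 - 2 * X) \<le> l' * (1 - X)"
  shows "l' / (m - 1) \<ge> l / m + 7 / 10 * e / m"
proof -
  define F where "F = l / m"
  define y where "y = m * X"
  \<comment> \<open>The deficit of \<open>y\<close> will be at least \<open>7 / 4 * e\<close>. The
    spare \<open>e / 4\<close> pays for the lower-order terms, since
    \<open>m * (e / 4) \<ge> 1 \<ge> y\<close>.\<close>
  define c where "c = 3 / 2 * e"
  have m0: "m > 0" using m by simp
  have lF: "l = F * m" and Xy: "X = y / m" using m0 by (auto simp: F_def y_def)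
  have F: "F \<ge> a - b" using l m0 by (simp add: F_def pos_le_divide_eq)
  have ae: "a - e > 0" "a - b > 0" using a e b by auto
  have y: "0 \<le> y" "y \<le> 1" using X m0 by (auto simp: y_def)
  have "m * (y * (F\<^sup>2 + (a - e) * (1 - (a - e)))) \<le> m * (a - e)"
  proof -
    have "X * (l\<^sup>2 + (a - e) * m * (m - (a - e) * m)) = m * (y * (F\<^sup>2 + (a - e) * (1 - (a - e))))"
      using m0 unfolding lF Xy by (simp add: power2_eq_square divide_simps) (simp add: algebra_simps)
    then show ?thesis using small by (simp only: mult.commute)
  qed
  then have 1: "y * (F\<^sup>2 + (a - e) * (1 - (a - e))) \<le> a - e" using m0 by simp
  have "(a - b)\<^sup>2 \<le> F\<^sup>2" using F ae by (intro power_mono) auto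
  \<comment> \<open>The only loss in expanding the square is \<open>2 * a * b\<close>, at most
    \<open>a * e / 10\<close> because \<open>b \<le> e / 20\<close>.\<close>
  moreover have "(a - b)\<^sup>2 \<ge> (a - e) * (a + 9 / 10 * e)"
  proof -
    have "2 * a * b \<le> 2 * a * (e / 20)" using a b by (intro mult_left_mono) auto
    moreover have "(a - b)\<^sup>2 - (a - e) * (a + 9 / 10 * e) = (2 * a * (e / 20) - 2 * a * b) + (b\<^sup>2 + 9 / 10 * e\<^sup>2)"
      by (simp add: field_simps power2_eq_square)
    moreover have "b\<^sup>2 + 9 / 10 * e\<^sup>2 \<ge> 0" by simp
    ultimately show ?thesis by linarith
  qed
  moreover have "(a - e) * (1 + 19 / 10 * e) = (a - e) * (a + 9 / 10 * e) + (a - e) * (1 - (a - e))"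
    by (simp add: field_simps)
  ultimately have "(a - e) * (1 + 19 / 10 * e) \<le> F\<^sup>2 + (a - e) * (1 - (a - e))"
    by linarith
  then have "y * ((a - e) * (1 + 19 / 10 * e)) \<le> y * (F\<^sup>2 + (a - e) * (1 - (a - e)))"
    using y by (intro mult_left_mono)
  then have "(a - e) * (y * (1 + 19 / 10 * e)) \<le> (a - e) * 1" using 1 by (simp add: mult_ac)
  then have 2: "y * (1 + 19 / 10 * e) \<le> 1" using ae by (simp only: mult_le_cancel_left_pos)
  have "y \<le> 1 - 7 / 4 * e"
  proof (rule ccontr)
    assume "\<not> ?thesis"
    then have "(1 - 7 / 4 * e) * (1 + 19 / 10 * e) < y * (1 + 19 / 10 * e)" using e by (intro mult_strict_right_mono) auto
    then have "(1 - 7 / 4 * e) * (1 + 19 / 10 * e) < 1" using 2 by linarith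
    moreover have "e * e \<le> e * (1 / 32)" using e by (intro mult_left_mono) auto
    ultimately show False using e by (simp add: algebra_simps)
  qed
  then have "1 - y - c \<ge> e / 4" by (simp add: c_def)
  then have "m * (1 - y - c) \<ge> m * (e / 4)" using m0 by (intro mult_left_mono) auto
  then have gap: "m * (1 - y - c) \<ge> y" using m y by linarith
  have c0: "c > 0" using e by (simp add: c_def)
  have "m * (m * (1 - y - c)) \<ge> m * y" using gap m0 by (intro mult_left_mono) auto
  moreover have "c * ((1 + y) * m - y) \<ge> 0"
  proof -
    have "y * 1 \<le> y * m" using m y by (intro mult_left_mono) auto
    moreover have "(1 + y) * m - y = m + (y * m - y * 1)" by (simp add: algebra_simps)
    ultimately have "(1 + y) * m - y \<ge> 0" using m0 by linarith
    then show ?thesis using c0 by (intro mult_nonneg_nonneg) auto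
  qed
  ultimately have poly: "(m + c) * (m - 1) * (m - y) \<le> m\<^sup>2 * (m - 2 * y)"
    by (simp add: algebra_simps power2_eq_square)
  have l0: "l > 0" using l ae m0 by (smt (verit) mult_pos_pos)
  have my: "m - y > 0" using m y by simp
  have "l * (m - 2 * y) \<le> l' * (m - y)"
  proof -
    have "m * (l * (1 - 2 * X)) \<le> m * (l' * (1 - X))" using l' m0 by (intro mult_left_mono) auto
    then show ?thesis by (simp add: y_def algebra_simps)
  qed
  then have "m\<^sup>2 * (l * (m - 2 * y)) \<le> m\<^sup>2 * (l' * (m - y))" by (intro mult_left_mono) auto
  moreover have "l * ((m + c) * (m - 1) * (m - y)) \<le> l * (m\<^sup>2 * (m - 2 * y))"
    using poly l0 by (intro mult_left_mono) auto
  ultimately have "(l * ((m + c) * (m - 1))) * (m - y) \<le> (m\<^sup>2 * l') * (m - y)" by (simp add: mult_ac)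
  then have "l * ((m + c) * (m - 1)) \<le> m\<^sup>2 * l'" using my by (simp only: mult_le_cancel_right_pos)
  then have "l / m + l * c / m\<^sup>2 \<le> l' / (m - 1)"
    using m by (simp add: field_simps power2_eq_square)
  moreover have "l * c / m\<^sup>2 = F * c / m" using m0 by (simp add: F_def power2_eq_square)
  moreover have "7 / 10 * e / m \<le> F * c / m"
  proof (rule divide_right_mono)
    \<comment> \<open>\<open>7 / 15\<close> is the number that turns \<open>c = 3 / 2 * e\<close>
      into \<open>7 / 10 * e\<close>.\<close>
    have "F \<ge> 7 / 15" using F a b e by linarith
    then have "F * c \<ge> 7 / 15 * c" using c0 by (intro mult_right_mono) auto
    then show "7 / 10 * e \<le> F * c" by (simp add: c_def)
  qed (use m0 in auto)
  ultimately show ?thesis by linarith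
qed

text \<open>Absorbs the factor \<open>8 ^ (r - 1)\<close> that arises from Perron weights up to
  \<open>4 / m\<close> together with \<open>n \<le> 2 * m\<close>. Equality holds at
  \<open>r = 2\<close>.\<close>

lemma four_mult_eight_power_le: "r \<ge> 2 \<Longrightarrow> 4 * 8 ^ (r - 1) \<le> real r ^ (r + 3)"
proof (induction r rule: nat_induct_at_least)
  case base
  then show ?case by simp
next
  case (Suc r)
  have r: "real r \<ge> 2" using Suc by simp
  have S: "8 ^ (Suc r - 1) = 8 * (8 ^ (r - 1) :: real)"
    using Suc.hyps power_Suc[of "8::real" "r - 1"] by simp
  have "1 + real (r + 3) * (1 / real r) \<le> (1 + 1 / real r) ^ (r + 3)"
    by (rule Bernoulli_inequality) (rule order_trans[of _ 0]; simp)
  moreover have "1 + real (r + 3) * (1 / real r) \<ge> 2" using r by (simp add: field_simps)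
  ultimately have B: "(1 + 1 / real r) ^ (r + 3) \<ge> 2" by linarith
  show ?case
  \<comment> \<open>Of the required factor \<open>8\<close>, Bernoulli supplies \<open>2\<close> and
    \<open>r + 1\<close> must supply \<open>4\<close>, which it does from \<open>r = 3\<close>
    on.\<close>
  proof (cases "r = 2")
    case True
    then show ?thesis by simp
  next
    case False
    then have r3: "real r + 1 \<ge> 4" using Suc.hyps by linarith
    have "4 * 8 ^ (Suc r - 1) = 8 * (4 * 8 ^ (r - 1) :: real)" using S by simp
    also have "\<dots> \<le> 8 * real r ^ (r + 3)" using Suc.IH by simp
    also have "\<dots> \<le> (2 * real r ^ (r + 3)) * (real r + 1)"
      using mult_left_mono[OF r3, of "2 * real r ^ (r + 3)"] by simp
    also have "2 * real r ^ (r + 3) \<le> (1 + 1 / real r) ^ (r + 3) * real r ^ (r + 3)"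
      using B by (intro mult_right_mono) auto
    also have "\<dots> = (real r + 1) ^ (r + 3)"
      using r by (simp add: power_mult_distrib[symmetric] field_simps)
    also have "(real r + 1) ^ (r + 3) * (real r + 1) = real (Suc r) ^ (Suc r + 3)"
      by (metis add_Suc of_nat_Suc power_Suc2 add.commute)
    finally show ?thesis by simp
  qed
qed

lemma square_root_le_mean:
  fixes l A B :: real
  assumes "l\<^sup>2 \<le> A * B" "A + B \<ge> 0"
  shows "l \<le> (A + B) / 2"
proof (rule power2_le_imp_le)
  have "0 \<le> (A - B)\<^sup>2" by simp
  then show "l\<^sup>2 \<le> ((A + B) / 2)\<^sup>2" using assms by (simp add: field_simps power2_eq_square)
qed (use assms in simp)

section \<open>Weighted cliques\<close>

text \<open>The relation stays fixed and only the vertex set varies, so deleting a vertex just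
  shrinks the argument \<open>V\<close>.\<close>

locale simple_adjacency =
  fixes E :: "'a \<Rightarrow> 'a \<Rightarrow> bool"
  assumes sym: "E u v \<Longrightarrow> E v u" and irrefl: "\<not> E u u"
begin

definition nbrs :: "'a set \<Rightarrow> 'a \<Rightarrow> 'a set" where
  "nbrs V u = {v \<in> V. E u v}"

definition common_nbrs :: "'a set \<Rightarrow> 'a set \<Rightarrow> 'a set" where
  "common_nbrs V R = {w \<in> V. \<forall>u\<in>R. E u w}"

definition cliques :: "'a set \<Rightarrow> nat \<Rightarrow> 'a set set" where
  "cliques V s = {R. R \<subseteq> V \<and> card R = s \<and> pairwise E R}"

definition clique_weight :: "'a set \<Rightarrow> ('a \<Rightarrow> real) \<Rightarrow> nat \<Rightarrow> real" where
  "clique_weight V y s = (\<Sum>R\<in>cliques V s. prod y R)"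

text \<open>Every edge is counted in both orders: this is the quadratic form of the adjacency matrix
  of \<open>V\<close>.\<close>

definition adj_form :: "'a set \<Rightarrow> ('a \<Rightarrow> real) \<Rightarrow> real" where
  "adj_form V x = (\<Sum>u\<in>V. \<Sum>v\<in>nbrs V u. x u * x v)"

lemma finite_nbrs [simp]: "finite V \<Longrightarrow> finite (nbrs V u)"
  by (simp add: nbrs_def)

lemma finite_common_nbrs [simp]: "finite V \<Longrightarrow> finite (common_nbrs V R)"
  by (simp add: common_nbrs_def)

lemma finite_cliques [simp]: "finite V \<Longrightarrow> finite (cliques V s)"
  unfolding cliques_def by (rule finite_subset[of _ "Pow V"]) auto

lemma cliquesD:
  assumes "finite V" "R \<in> cliques V s"
  shows "finite R" "R \<subseteq> V" "card R = s" "pairwise E R"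
  using assms finite_subset unfolding cliques_def by auto

lemma cliques_mono: "W \<subseteq> V \<Longrightarrow> cliques W s \<subseteq> cliques V s"
  unfolding cliques_def by auto

lemma insert_cliques:
  assumes "finite V" "T \<in> cliques V s" "w \<in> common_nbrs V T"
  shows "insert w T \<in> cliques V (Suc s)" "w \<notin> T"
proof -
  show "w \<notin> T" using assms irrefl by (auto simp: common_nbrs_def)
  then show "insert w T \<in> cliques V (Suc s)"
    using assms sym finite_subset[of T V] unfolding cliques_def common_nbrs_def
    by (auto simp: pairwise_insert)
qed

lemma remove_cliques:
  assumes "finite V" "R \<in> cliques V (Suc s)" "w \<in> R"
  shows "R - {w} \<in> cliques V s" "w \<in> common_nbrs V (R - {w})"
  using assms finite_subset[of R V] unfolding cliques_def common_nbrs_def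
  by (auto simp: pairwise_def)

text \<open>Both sides sum over the pairs of an \<open>(s+1)\<close>-clique with a distinguished vertex.\<close>

lemma sum_clique_flags:
  fixes g :: "'a set \<Rightarrow> 'a \<Rightarrow> real"
  assumes "finite V"
  shows "(\<Sum>T\<in>cliques V s. \<Sum>w\<in>common_nbrs V T. g T w) =
         (\<Sum>R\<in>cliques V (Suc s). \<Sum>w\<in>R. g (R - {w}) w)"
proof -
  have "(\<Sum>T\<in>cliques V s. \<Sum>w\<in>common_nbrs V T. g T w) =
        (\<Sum>(T,w)\<in>(SIGMA T:cliques V s. common_nbrs V T). g T w)"
    using assms by (subst sum.Sigma) auto
  also have "\<dots> = (\<Sum>(R,w)\<in>(SIGMA R:cliques V (Suc s). R). g (R - {w}) w)"
    by (rule sum.reindex_bij_witness[where i = "\<lambda>(R,w). (R - {w}, w)" and j = "\<lambda>(T,w). (insert w T, w)"])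
       (use insert_cliques[OF assms] remove_cliques[OF assms] in auto)
  also have "\<dots> = (\<Sum>R\<in>cliques V (Suc s). \<Sum>w\<in>R. g (R - {w}) w)"
    using assms cliquesD(1)[OF assms] by (subst sum.Sigma) auto
  finally show ?thesis .
qed

lemma clique_weight_nonneg:
  assumes "finite V" "\<And>v. v \<in> V \<Longrightarrow> y v \<ge> 0"
  shows "clique_weight V y s \<ge> 0"
  unfolding clique_weight_def by (intro sum_nonneg prod_nonneg) (use assms cliquesD in blast)

lemma prod_remove_clique:
  fixes y :: "'a \<Rightarrow> real"
  assumes "finite V" "R \<in> cliques V s" "w \<in> R"
  shows "prod y (R - {w}) * y w = prod y R"
  using prod.remove[OF cliquesD(1)[OF assms(1,2)] assms(3), of y] by simp

text \<open>A clique of order \<open>s + 1\<close> arises once from each of its \<open>s + 1\<close>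
  vertices as the added one.\<close>

lemma clique_weight_Suc:
  assumes "finite V"
  shows "(\<Sum>T\<in>cliques V s. prod y T * sum y (common_nbrs V T)) = real (Suc s) * clique_weight V y (Suc s)"
proof -
  have "(\<Sum>T\<in>cliques V s. prod y T * sum y (common_nbrs V T)) =
        (\<Sum>R\<in>cliques V (Suc s). \<Sum>w\<in>R. prod y (R - {w}) * y w)"
    using sum_clique_flags[OF assms, where s = s and g = "\<lambda>T w. prod y T * y w"] by (simp add: sum_distrib_left)
  also have "\<dots> = (\<Sum>R\<in>cliques V (Suc s). \<Sum>w\<in>R. prod y R)"
    by (intro sum.cong refl) (use prod_remove_clique[OF assms] in auto)
  also have "\<dots> = real (Suc s) * clique_weight V y (Suc s)"
    unfolding clique_weight_def sum_distrib_left
    by (intro sum.cong refl) (use cliquesD(3)[OF assms] in auto)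
  finally show ?thesis .
qed

section \<open>The Moon--Moser inequality with weights\<close>

lemma sum_common_nbrs:
  fixes y :: "'a \<Rightarrow> real"
  assumes "finite V"
  shows "sum y (common_nbrs V R) = (\<Sum>z\<in>V. if z \<in> common_nbrs V R then y z else 0)"
  using sum.inter_filter[OF assms, of y "\<lambda>z. z \<in> common_nbrs V R"]
  by (simp add: common_nbrs_def cong: conj_cong)

text \<open>A vertex adjacent to all of \<open>R\<close> is counted \<open>s + 1\<close> times on the left, any other vertex
  at most once.\<close>

lemma sum_common_nbrs_remove_le:
  fixes y :: "'a \<Rightarrow> real"
  assumes "finite V" "\<And>v. v \<in> V \<Longrightarrow> y v \<ge> 0" "R \<in> cliques V (Suc s)"
  shows "(\<Sum>w\<in>R. sum y (common_nbrs V (R - {w}))) \<le> sum y V + real s * sum y (common_nbrs V R)"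
proof -
  have fR: "finite R" and cR: "card R = Suc s" using cliquesD[OF assms(1,3)] by auto
  have "(\<Sum>w\<in>R. sum y (common_nbrs V (R - {w}))) =
        (\<Sum>w\<in>R. \<Sum>z\<in>V. if z \<in> common_nbrs V (R - {w}) then y z else 0)"
    using sum_common_nbrs[OF assms(1)] by simp
  also have "\<dots> = (\<Sum>z\<in>V. \<Sum>w\<in>R. if z \<in> common_nbrs V (R - {w}) then y z else 0)"
    by (rule sum.swap)
  also have "\<dots> = (\<Sum>z\<in>V. real (card {w\<in>R. z \<in> common_nbrs V (R - {w})}) * y z)"
    using fR by (intro sum.cong refl) (auto simp: sum.If_cases Int_def)
  also have "\<dots> \<le> (\<Sum>z\<in>V. y z + real s * (if z \<in> common_nbrs V R then y z else 0))"
  proof (rule sum_mono)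
    fix z assume z: "z \<in> V"
    let ?S = "{w\<in>R. z \<in> common_nbrs V (R - {w})}"
    show "real (card ?S) * y z \<le> y z + real s * (if z \<in> common_nbrs V R then y z else 0)"
    proof (cases "z \<in> common_nbrs V R")
      case True
      have "card ?S \<le> Suc s" using card_mono[OF fR, of ?S] cR by auto
      then have "real (card ?S) * y z \<le> real (Suc s) * y z"
        by (intro mult_right_mono) (use assms z in auto)
      then show ?thesis using True by (simp add: algebra_simps)
    next
      case False
      then obtain w0 where w0: "w0 \<in> R" "\<not> E w0 z" using z by (auto simp: common_nbrs_def)
      then have "?S \<subseteq> {w0}" by (auto simp: common_nbrs_def)
      then have "card ?S \<le> 1" using card_mono[of "{w0}" ?S] by simp
      then have "real (card ?S) * y z \<le> 1 * y z"
        by (intro mult_right_mono) (use assms z in auto)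
      then show ?thesis using False by simp
    qed
  qed
  also have "\<dots> = sum y V + real s * sum y (common_nbrs V R)"
    by (simp add: sum.distrib sum_distrib_left[symmetric] sum_common_nbrs[OF assms(1)])
  finally show ?thesis .
qed

text \<open>Cauchy--Schwarz for the extension weights \<open>d T\<close>, with
  \<open>prod y T\<close> as the measure on \<open>s\<close>-cliques. The mean of \<open>d\<close>
  is a clique weight of order \<open>s + 1\<close>. The second moment, regrouped by
  \<open>(s + 1)\<close>-cliques \<open>R\<close>, is a sum of \<open>d (R - {w})\<close> over
  \<open>w\<close>, which the preceding lemma bounds.\<close>

lemma moon_moser_weighted:
  assumes "finite V" "\<And>v. v \<in> V \<Longrightarrow> y v \<ge> 0"
  shows "(real (Suc s) * clique_weight V y (Suc s))\<^sup>2 \<le>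
    clique_weight V y s * (sum y V * clique_weight V y (Suc s)
      + real s * (real (s + 2) * clique_weight V y (s + 2)))"
proof -
  define d where "d T = sum y (common_nbrs V T)" for T
  have pos: "prod y T \<ge> 0" if "T \<in> cliques V k" for T k
    by (rule prod_nonneg) (use assms cliquesD[OF assms(1) that] in blast)
  have Suc: "(\<Sum>T\<in>cliques V k. prod y T * d T) = real (Suc k) * clique_weight V y (Suc k)" for k
    using clique_weight_Suc[OF assms(1)] by (simp add: d_def)
  have sq: "(\<Sum>w\<in>common_nbrs V T. prod y T * y w * d T) = prod y T * (d T)\<^sup>2" for T
  proof -
    have "(\<Sum>w\<in>common_nbrs V T. prod y T * y w * d T) = prod y T * d T * sum y (common_nbrs V T)"
      unfolding sum_distrib_left by (intro sum.cong refl) (simp only: mult_ac)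
    then show ?thesis by (simp add: d_def[symmetric] power2_eq_square)
  qed
  have "(real (Suc s) * clique_weight V y (Suc s))\<^sup>2 = (\<Sum>T\<in>cliques V s. prod y T * d T)\<^sup>2"
    using Suc by simp
  also have "\<dots> = (\<Sum>T\<in>cliques V s. sqrt (prod y T) * (sqrt (prod y T) * d T))\<^sup>2"
    using pos by (simp add: mult.assoc[symmetric])
  also have "\<dots> \<le> (\<Sum>T\<in>cliques V s. (sqrt (prod y T))\<^sup>2) * (\<Sum>T\<in>cliques V s. (sqrt (prod y T) * d T)\<^sup>2)"
    by (rule Cauchy_Schwarz_ineq_sum)
  also have "\<dots> = clique_weight V y s * (\<Sum>T\<in>cliques V s. prod y T * (d T)\<^sup>2)"
    unfolding clique_weight_def using pos by (simp add: power_mult_distrib)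
  also have "\<dots> \<le> clique_weight V y s * (sum y V * clique_weight V y (Suc s)
      + real s * (real (s + 2) * clique_weight V y (s + 2)))"
  proof (rule mult_left_mono)
    have "(\<Sum>T\<in>cliques V s. prod y T * (d T)\<^sup>2) =
        (\<Sum>T\<in>cliques V s. \<Sum>w\<in>common_nbrs V T. prod y T * y w * d T)"
      by (simp only: sq)
    also have "\<dots> = (\<Sum>R\<in>cliques V (Suc s). \<Sum>w\<in>R. prod y (R - {w}) * y w * d (R - {w}))"
      by (rule sum_clique_flags[OF assms(1)])
    also have "\<dots> = (\<Sum>R\<in>cliques V (Suc s). prod y R * (\<Sum>w\<in>R. d (R - {w})))"
      unfolding sum_distrib_left
      by (intro sum.cong refl) (simp add: prod_remove_clique[OF assms(1)])
    also have "\<dots> \<le> (\<Sum>R\<in>cliques V (Suc s). prod y R * (sum y V + real s * d R))"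
      unfolding d_def
      by (intro sum_mono mult_left_mono sum_common_nbrs_remove_le assms pos)
    also have "\<dots> = sum y V * clique_weight V y (Suc s) + real s * (\<Sum>R\<in>cliques V (Suc s). prod y R * d R)"
      unfolding clique_weight_def sum_distrib_left sum.distrib[symmetric]
      by (intro sum.cong refl) (simp add: distrib_left mult_ac)
    finally show "(\<Sum>T\<in>cliques V s. prod y T * (d T)\<^sup>2) \<le> sum y V * clique_weight V y (Suc s)
      + real s * (real (s + 2) * clique_weight V y (s + 2))"
      using Suc[of "Suc s"] by simp
  qed (use clique_weight_nonneg[OF assms] in auto)
  finally show ?thesis .
qed

lemma cliques_0: "cliques V 0 = {{}}" if "finite V"
  using that by (auto simp: cliques_def dest: finite_subset)

lemma clique_weight_1: "clique_weight V y (Suc 0) = sum y V" if "finite V"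
  using clique_weight_Suc[OF that, where s = 0 and y = y] cliques_0[OF that]
  by (simp add: common_nbrs_def)

lemma clique_weight_2: "2 * clique_weight V y (Suc (Suc 0)) = adj_form V y" if "finite V"
proof -
  have 1: "cliques V (Suc 0) = (\<lambda>v. {v}) ` V"
    by (auto simp: cliques_def card_Suc_eq)
  have "2 * clique_weight V y (Suc (Suc 0)) = (\<Sum>T\<in>cliques V (Suc 0). prod y T * sum y (common_nbrs V T))"
    using clique_weight_Suc[OF that, where s = "Suc 0" and y = y] by simp
  also have "\<dots> = adj_form V y"
    unfolding 1 by (subst sum.reindex) (auto simp: adj_form_def sum_distrib_left common_nbrs_def nbrs_def)
  finally show ?thesis .
qed

lemma adj_form_nonneg_le:
  assumes "finite V" "\<And>v. v \<in> V \<Longrightarrow> y v \<ge> 0"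
  shows "adj_form V y \<le> (sum y V)\<^sup>2"
proof -
  have "adj_form V y \<le> (\<Sum>u\<in>V. \<Sum>v\<in>V. y u * y v)"
    unfolding adj_form_def
    by (intro sum_mono sum_mono2) (use assms in \<open>auto simp: nbrs_def\<close>)
  also have "\<dots> = (sum y V)\<^sup>2" by (simp add: power2_eq_square sum_product)
  finally show ?thesis .
qed

text \<open>\<open>binomial(r, s) / r^s\<close> is the value for uniform weights on a balanced
  complete \<open>r\<close>-partite graph. The two claims are proved together, since the second
  keeps the weight of order \<open>s\<close> positive, which allows dividing the Moon--Moser
  inequality by it.\<close>

lemma clique_weight_lower_bound:
  assumes V: "finite V" "\<And>v. v \<in> V \<Longrightarrow> y v \<ge> 0" "sum y V = 1"
    and t: "adj_form V y > 1 - 1 / real r" and "1 \<le> s" "s \<le> r"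
  shows "real (Suc s) * clique_weight V y (Suc s) \<ge> (1 - real s * (1 - adj_form V y)) * clique_weight V y s
    \<and> clique_weight V y s \<ge> real (r choose s) / real r ^ s"
  using \<open>1 \<le> s\<close> \<open>s \<le> r\<close>
proof (induction s rule: nat_induct_at_least)
  case base
  then show ?case using V clique_weight_1[OF V(1), of y] clique_weight_2[OF V(1), of y] by simp
next
  case (Suc s)
  let ?k = "clique_weight V y" and ?t = "adj_form V y"
  have r: "real r > 0" and sr: "s \<le> r" using Suc by auto
  have IH1: "real (Suc s) * ?k (Suc s) \<ge> (1 - real s * (1 - ?t)) * ?k s"
    and IH2: "?k s \<ge> real (r choose s) / real r ^ s" using Suc by auto
  have "real (r choose s) / real r ^ s > 0" using sr r by (simp add: binomial_eq_0_iff)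
  then have ks: "?k s > 0" using IH2 by linarith
  have p: "1 - real j * (1 - ?t) \<ge> (real r - real j) / real r" for j
  proof -
    have "real j * (1 - ?t) \<le> real j * (1 / real r)" using t by (intro mult_left_mono) auto
    then show ?thesis using r by (simp add: field_simps)
  qed
  have "real (Suc s) * (real (r choose Suc s) / real r ^ Suc s) =
        (real r - real s) / real r * (real (r choose s) / real r ^ s)"
    using r real_binomial_Suc[OF sr] by (simp add: field_simps)
  also have "\<dots> \<le> (1 - real s * (1 - ?t)) * ?k s"
  proof (rule mult_mono)
    show "0 \<le> 1 - real s * (1 - ?t)" by (rule order_trans[OF _ p[of s]]) (use sr r in simp)
  qed (use sr r IH2 p[of s] in auto)
  also have "\<dots> \<le> real (Suc s) * ?k (Suc s)" by (rule IH1)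
  finally have c2: "?k (Suc s) \<ge> real (r choose Suc s) / real r ^ Suc s"
    by (simp only: mult_le_cancel_left_pos of_nat_0_less_iff zero_less_Suc)
  have kS: "?k (Suc s) \<ge> 0" by (rule clique_weight_nonneg) (use V in auto)
  let ?p = "1 - real s * (1 - ?t)"
  have "(?p * ?k s) * (real (Suc s) * ?k (Suc s)) \<le> (real (Suc s) * ?k (Suc s)) * (real (Suc s) * ?k (Suc s))"
    using IH1 kS by (intro mult_right_mono) auto
  also have "\<dots> \<le> ?k s * (?k (Suc s) + real s * (real (s + 2) * ?k (s + 2)))"
    using moon_moser_weighted[OF V(1), of y s] V(2,3) by (simp add: power2_eq_square)
  finally have "?k s * (?p * (real (Suc s) * ?k (Suc s))) \<le> ?k s * (?k (Suc s) + real s * (real (s + 2) * ?k (s + 2)))"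
    by (simp only: mult_ac)
  then have "?p * (real (Suc s) * ?k (Suc s)) \<le> ?k (Suc s) + real s * (real (s + 2) * ?k (s + 2))"
    using ks by simp
  \<comment> \<open>The coefficients advance because \<open>(s + 1) * (1 - s * (1 - t)) - 1 = s * (1
    - (s + 1) * (1 - t))\<close>.\<close>
  then have "real s * ((1 - real (Suc s) * (1 - ?t)) * ?k (Suc s)) \<le> real s * (real (s + 2) * ?k (s + 2))"
    by (simp add: algebra_simps)
  then have "(1 - real (Suc s) * (1 - ?t)) * ?k (Suc s) \<le> real (s + 2) * ?k (s + 2)"
    using Suc.hyps by simp
  then show ?case using c2 by simp
qed

section \<open>Cliques through an edge and the Motzkin--Straus bound\<close>

lemma sum_clique_edges:
  fixes h :: "'a \<Rightarrow> 'a \<Rightarrow> real"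
  assumes "finite V"
  shows "(\<Sum>R\<in>cliques V s. \<Sum>u\<in>R. \<Sum>v\<in>R - {u}. h u v) =
         (\<Sum>u\<in>V. \<Sum>v\<in>nbrs V u. real (card {R\<in>cliques V s. u \<in> R \<and> v \<in> R}) * h u v)"
proof -
  let ?P = "SIGMA u:V. nbrs V u"
  have fP: "finite ?P" using assms by auto
  have "(\<Sum>R\<in>cliques V s. \<Sum>u\<in>R. \<Sum>v\<in>R - {u}. h u v) =
        (\<Sum>R\<in>cliques V s. \<Sum>p\<in>?P. if fst p \<in> R \<and> snd p \<in> R then h (fst p) (snd p) else 0)"
  proof (intro sum.cong refl)
    fix R assume R: "R \<in> cliques V s"
    have eq: "{p\<in>?P. fst p \<in> R \<and> snd p \<in> R} = (SIGMA u:R. R - {u})"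
      using cliquesD[OF assms R] irrefl by (auto simp: nbrs_def pairwise_def)
    have "(\<Sum>u\<in>R. \<Sum>v\<in>R - {u}. h u v) = (\<Sum>p\<in>(SIGMA u:R. R - {u}). h (fst p) (snd p))"
      using cliquesD(1)[OF assms R] by (subst sum.Sigma) (auto simp: case_prod_unfold)
    also have "\<dots> = (\<Sum>p\<in>?P. if fst p \<in> R \<and> snd p \<in> R then h (fst p) (snd p) else 0)"
      unfolding eq[symmetric] by (rule sum.inter_filter[OF fP])
    finally show "(\<Sum>u\<in>R. \<Sum>v\<in>R - {u}. h u v) =
      (\<Sum>p\<in>?P. if fst p \<in> R \<and> snd p \<in> R then h (fst p) (snd p) else 0)" .
  qed
  also have "\<dots> = (\<Sum>p\<in>?P. \<Sum>R\<in>cliques V s. if fst p \<in> R \<and> snd p \<in> R then h (fst p) (snd p) else 0)"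
    by (rule sum.swap)
  also have "\<dots> = (\<Sum>p\<in>?P. real (card {R\<in>cliques V s. fst p \<in> R \<and> snd p \<in> R}) * h (fst p) (snd p))"
    using assms by (intro sum.cong refl) (simp add: sum.inter_filter[symmetric])
  also have "\<dots> = (\<Sum>u\<in>V. \<Sum>v\<in>nbrs V u. real (card {R\<in>cliques V s. u \<in> R \<and> v \<in> R}) * h u v)"
    using assms by (subst sum.Sigma) (auto simp: case_prod_unfold)
  finally show ?thesis .
qed

text \<open>The form in which the failure of the first alternative is used: all cliques through one
  edge form a joint.\<close>

definition edge_cliques_le :: "'a set \<Rightarrow> nat \<Rightarrow> real \<Rightarrow> bool" where
  "edge_cliques_le V s J \<longleftrightarrow>
     (\<forall>u\<in>V. \<forall>v\<in>V. E u v \<longrightarrow> real (card {R\<in>cliques V s. u \<in> R \<and> v \<in> R}) \<le> J)"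

lemma edge_cliques_le_mono:
  assumes "finite V" "W \<subseteq> V" "edge_cliques_le V s J"
  shows "edge_cliques_le W s J"
  unfolding edge_cliques_le_def
proof (intro ballI impI)
  fix u v assume uv: "u \<in> W" "v \<in> W" "E u v"
  have "card {R\<in>cliques W s. u \<in> R \<and> v \<in> R} \<le> card {R\<in>cliques V s. u \<in> R \<and> v \<in> R}"
    using assms cliques_mono[OF assms(2), of s] by (intro card_mono) auto
  moreover have "real (card {R\<in>cliques V s. u \<in> R \<and> v \<in> R}) \<le> J"
    using assms(2,3) uv unfolding edge_cliques_le_def by blast
  ultimately show "real (card {R\<in>cliques W s. u \<in> R \<and> v \<in> R}) \<le> J" by linarith
qed

text \<open>Charge each clique to its \<open>r * (r + 1)\<close> ordered edges. For the edge
  \<open>u\<close>, \<open>v\<close> keep \<open>y u * y v\<close> and bound the other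
  \<open>r - 1\<close> factors by \<open>Y\<close>; then each edge is charged at most
  \<open>J\<close> times, and the sum of \<open>y u * y v\<close> over edges is at most
  \<open>1\<close>.\<close>

lemma clique_weight_upper_bound:
  assumes V: "finite V" "\<And>v. v \<in> V \<Longrightarrow> 0 \<le> y v \<and> y v \<le> Y" "sum y V = 1"
    and J: "J \<ge> 0" "edge_cliques_le V (Suc r) J" and "r \<ge> 1" "Y \<ge> 0"
  shows "real r * (real (Suc r) * clique_weight V y (Suc r)) \<le> Y ^ (r - 1) * J"
proof -
  have "real r * (real (Suc r) * clique_weight V y (Suc r)) =
        (\<Sum>R\<in>cliques V (Suc r). \<Sum>u\<in>R. \<Sum>v\<in>R - {u}. prod y R)"
    unfolding clique_weight_def sum_distrib_left
    by (intro sum.cong refl) (use cliquesD[OF V(1)] in simp)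
  also have "\<dots> \<le> (\<Sum>R\<in>cliques V (Suc r). \<Sum>u\<in>R. \<Sum>v\<in>R - {u}. y u * y v * Y ^ (r - 1))"
  proof (intro sum_mono)
    fix R u v assume R: "R \<in> cliques V (Suc r)" and u: "u \<in> R" and v: "v \<in> R - {u}"
    note D = cliquesD[OF V(1) R]
    have "prod y R = y u * (y v * prod y (R - {u} - {v}))"
      using prod.remove[OF D(1) u, of y] prod.remove[OF _ v, of y] D(1) by simp
    moreover have "prod y (R - {u} - {v}) \<le> prod (\<lambda>_. Y) (R - {u} - {v})"
      using D(2) V(2) by (intro prod_mono) auto
    moreover have "card (R - {u} - {v}) = r - 1" using D u v by auto
    ultimately show "prod y R \<le> y u * y v * Y ^ (r - 1)"
      using D(2) V(2) u v by (simp add: mult.assoc mult_left_mono subset_iff)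
  qed
  also have "\<dots> = (\<Sum>u\<in>V. \<Sum>v\<in>nbrs V u. real (card {R\<in>cliques V (Suc r). u \<in> R \<and> v \<in> R}) * (y u * y v * Y ^ (r - 1)))"
    by (rule sum_clique_edges[OF V(1)])
  also have "\<dots> \<le> (\<Sum>u\<in>V. \<Sum>v\<in>nbrs V u. J * (y u * y v * Y ^ (r - 1)))"
    using J(2) V(2) \<open>Y \<ge> 0\<close> unfolding edge_cliques_le_def
    by (intro sum_mono mult_right_mono) (auto simp: nbrs_def)
  also have "\<dots> = Y ^ (r - 1) * J * adj_form V y"
    unfolding adj_form_def sum_distrib_left by (intro sum.cong refl) (simp only: mult_ac)
  also have "\<dots> \<le> Y ^ (r - 1) * J * 1"
    using adj_form_nonneg_le[OF V(1), of y] V J(1) \<open>Y \<ge> 0\<close> by (intro mult_left_mono) auto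
  finally show ?thesis by simp
qed

text \<open>With \<open>J = 0\<close> this is the theorem of Motzkin and Straus.\<close>

lemma adj_form_le:
  assumes V: "finite V" "\<And>v. v \<in> V \<Longrightarrow> 0 \<le> y v \<and> y v \<le> Y" "sum y V = 1"
    and J: "J \<ge> 0" "edge_cliques_le V (Suc r) J" and r: "r \<ge> 2" and Y: "Y \<ge> 0"
  shows "adj_form V y \<le> 1 - 1 / real r + Y ^ (r - 1) * J * real r ^ (r - 2)"
proof (cases "adj_form V y > 1 - 1 / real r")
  case True
  let ?k = "clique_weight V y" and ?t = "adj_form V y"
  have r0: "real r > 0" using r by simp
  \<comment> \<open>At \<open>s = r\<close> the factor \<open>1 - r * (1 - t)\<close> equals
    \<open>r\<close> times the excess of \<open>t\<close> over \<open>1 - 1 / r\<close>, so an upper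
    bound on the weight of \<open>(r + 1)\<close>-cliques bounds this excess.\<close>
  have b: "real (Suc r) * ?k (Suc r) \<ge> (1 - real r * (1 - ?t)) * ?k r" "?k r \<ge> 1 / real r ^ r"
    using clique_weight_lower_bound[OF V(1) _ V(3) True, of r] V r by auto
  have p: "1 - real r * (1 - ?t) \<ge> 0" using True r0 by (simp add: field_simps)
  have "real r * ((1 - real r * (1 - ?t)) * (1 / real r ^ r)) \<le> real r * ((1 - real r * (1 - ?t)) * ?k r)"
    using b(2) p by (intro mult_left_mono) auto
  also have "\<dots> \<le> real r * (real (Suc r) * ?k (Suc r))" using b(1) by (intro mult_left_mono) auto
  also have "\<dots> \<le> Y ^ (r - 1) * J"
    by (rule clique_weight_upper_bound[OF V J _ Y]) (use r in auto)
  finally have "real r * (1 - real r * (1 - ?t)) \<le> Y ^ (r - 1) * J * real r ^ r"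
    using r0 by (simp add: field_simps)
  also have "real r ^ r = real r ^ (r - 2) * real r ^ 2"
    using r by (metis add_diff_inverse_nat less_le_not_le linorder_not_less power_add mult.commute)
  also have "real r * (1 - real r * (1 - ?t)) = real r ^ 2 * (?t - (1 - 1 / real r))"
    using r0 by (simp add: field_simps power2_eq_square)
  finally have "real r ^ 2 * (?t - (1 - 1 / real r)) \<le> real r ^ 2 * (Y ^ (r - 1) * J * real r ^ (r - 2))"
    by (simp only: mult_ac)
  then show ?thesis using r0 by (simp add: mult_le_cancel_left_pos)
next
  case False
  have "Y ^ (r - 1) * J * real r ^ (r - 2) \<ge> 0" using J Y by simp
  then show ?thesis using False by linarith
qed

definition degree_sum :: "'a set \<Rightarrow> nat" where
  "degree_sum V = (\<Sum>u\<in>V. card (nbrs V u))"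

text \<open>The case of uniform weights \<open>1 / m\<close>, where \<open>adj_form\<close> becomes
  the degree sum over \<open>m^2\<close>.\<close>

lemma degree_sum_le:
  assumes V: "finite V" "V \<noteq> {}" 
    and J: "J \<ge> 0" "edge_cliques_le V (Suc r) J" and r: "r \<ge> 2"
  shows "real (degree_sum V) \<le>
    (1 - 1 / real r + (1 / real (card V)) ^ (r - 1) * J * real r ^ (r - 2)) * (real (card V))\<^sup>2"
proof -
  have m: "real (card V) > 0" using V by (simp add: card_gt_0_iff)
  have "adj_form V (\<lambda>_. 1 / real (card V)) = real (degree_sum V) / (real (card V))\<^sup>2"
    unfolding adj_form_def degree_sum_def
    by (simp add: sum_divide_distrib power2_eq_square)
  moreover have "adj_form V (\<lambda>_. 1 / real (card V)) \<le>
     1 - 1 / real r + (1 / real (card V)) ^ (r - 1) * J * real r ^ (r - 2)"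
    by (rule adj_form_le) (use assms m in auto)
  ultimately show ?thesis using m by (simp add: pos_divide_le_eq)
qed

section \<open>Counting extensions of cliques\<close>

lemma card_le_common_nbrs:
  assumes "finite U" "finite R" "\<And>u. u \<in> R \<Longrightarrow> real (card (U - nbrs U u)) \<le> g"
  shows "real (card U) \<le> real (card (common_nbrs U R)) + real (card R) * g"
proof -
  have "U \<subseteq> common_nbrs U R \<union> (\<Union>u\<in>R. U - nbrs U u)" by (auto simp: common_nbrs_def nbrs_def)
  then have "card U \<le> card (common_nbrs U R \<union> (\<Union>u\<in>R. U - nbrs U u))"
    using assms by (intro card_mono) auto
  also have "\<dots> \<le> card (common_nbrs U R) + card (\<Union>u\<in>R. U - nbrs U u)" by (rule card_Un_le)
  also have "card (\<Union>u\<in>R. U - nbrs U u) \<le> (\<Sum>u\<in>R. card (U - nbrs U u))"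
    using assms by (intro card_UN_le) auto
  finally have "real (card U) \<le> real (card (common_nbrs U R)) + (\<Sum>u\<in>R. real (card (U - nbrs U u)))"
    by (simp only: of_nat_sum[symmetric] of_nat_add[symmetric] of_nat_le_iff)
  also have "(\<Sum>u\<in>R. real (card (U - nbrs U u))) \<le> (\<Sum>u\<in>R. g)" by (intro sum_mono assms)
  finally show ?thesis by simp
qed

lemma card_cliques_Suc_ge:
  assumes "finite U" "\<And>u. u \<in> U \<Longrightarrow> real (card (U - nbrs U u)) \<le> g"
  shows "real (card (cliques U s)) * (real (card U) - real s * g) \<le> real (Suc s) * real (card (cliques U (Suc s)))"
proof -
  have "real (card (cliques U s)) * (real (card U) - real s * g) = (\<Sum>R\<in>cliques U s. real (card U) - real s * g)"
    by simp
  also have "\<dots> \<le> (\<Sum>R\<in>cliques U s. real (card (common_nbrs U R)))"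
  proof (rule sum_mono)
    fix R assume "R \<in> cliques U s"
    note D = cliquesD[OF assms(1) this]
    show "real (card U) - real s * g \<le> real (card (common_nbrs U R))"
      using card_le_common_nbrs[OF assms(1) D(1), of g] assms(2) D(2,3) by fastforce
  qed
  also have "\<dots> = real (Suc s) * real (card (cliques U (Suc s)))"
    using clique_weight_Suc[OF assms(1), where y = "\<lambda>_. 1" and s = s]
    by (simp add: clique_weight_def)
  finally show ?thesis .
qed

section \<open>Minimum degree\<close>

lemma non_nbrs_mono: "U \<subseteq> W \<Longrightarrow> U - nbrs U u \<subseteq> W - nbrs W u"
  by (auto simp: nbrs_def)

text \<open>Write \<open>d w\<close> for the number of neighbours of \<open>w\<close> in \<open>K\<close>. By integrality
  \<open>(d w - r) (d w - r + 1) \<ge> 0\<close>, which bounds the sum of all codegrees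
  \<open>\<Sum>w. d w (d w - 1)\<close> of pairs in \<open>K\<close> linearly in terms of the degrees.\<close>

lemma ex_large_codegree:
  assumes W: "finite W" "W \<noteq> {}" and r: "r \<ge> 2" and K: "K \<in> cliques W (Suc r)"
    and deg: "\<And>u. u \<in> W \<Longrightarrow> real (card (nbrs W u)) \<ge> (1 - 1 / real r - e) * real (card W)"
    and e: "e \<ge> 0"
  shows "\<exists>u\<in>K. \<exists>v\<in>K. u \<noteq> v \<and>
    real (card (common_nbrs W {u, v})) \<ge> ((real r - 2) / real r + 2 / (real r ^ 2 * (real r + 1)) - 2 * e) * real (card W)"
proof (rule ccontr)
  define m where "m = real (card W)"
  define B where "B = ((real r - 2) / real r + 2 / (real r ^ 2 * (real r + 1)) - 2 * e) * m"
  assume "\<not> ?thesis"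
  then have lt: "real (card (common_nbrs W {u, v})) < B" if "u \<in> K" "v \<in> K - {u}" for u v
    using that unfolding B_def m_def by force
  have m: "m > 0" using W by (simp add: m_def card_gt_0_iff)
  have r0: "real r > 0" using r by simp
  note D = cliquesD[OF W(1) K]
  define d where "d w = real (card {u\<in>K. E u w})" for w
  have deg_eq: "(\<Sum>w\<in>W. d w) = (\<Sum>u\<in>K. real (card (nbrs W u)))"
  proof -
    have "(\<Sum>w\<in>W. d w) = (\<Sum>w\<in>W. \<Sum>u\<in>K. if E u w then 1 else 0)"
      unfolding d_def using D(1) by (simp add: sum.inter_filter[symmetric])
    also have "\<dots> = (\<Sum>u\<in>K. \<Sum>w\<in>W. if E u w then 1 else 0)" by (rule sum.swap)
    also have "\<dots> = (\<Sum>u\<in>K. real (card (nbrs W u)))"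
      unfolding nbrs_def using W(1) by (simp add: sum.inter_filter[symmetric])
    finally show ?thesis .
  qed
  have codeg_eq: "(\<Sum>u\<in>K. \<Sum>v\<in>K - {u}. real (card (common_nbrs W {u, v}))) = (\<Sum>w\<in>W. d w * (d w - 1))"
  proof -
    have "(\<Sum>u\<in>K. \<Sum>v\<in>K - {u}. real (card (common_nbrs W {u, v}))) =
          (\<Sum>u\<in>K. \<Sum>v\<in>K - {u}. \<Sum>w\<in>W. if E u w \<and> E v w then 1 else 0)"
      unfolding common_nbrs_def using W(1) by (simp add: sum.inter_filter[symmetric])
    also have "\<dots> = (\<Sum>u\<in>K. \<Sum>w\<in>W. \<Sum>v\<in>K - {u}. if E u w \<and> E v w then 1 else 0)"
      by (intro sum.cong refl sum.swap)
    also have "\<dots> = (\<Sum>w\<in>W. \<Sum>u\<in>K. \<Sum>v\<in>K - {u}. if E u w \<and> E v w then 1 else 0)"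
      by (rule sum.swap)
    also have "\<dots> = (\<Sum>w\<in>W. d w * (d w - 1))"
    proof (rule sum.cong[OF refl])
      fix w
      have "(\<Sum>u\<in>K. \<Sum>v\<in>K - {u}. if E u w \<and> E v w then 1 else 0) = (\<Sum>u\<in>K. if E u w then d w - 1 else (0::real))"
      proof (rule sum.cong[OF refl])
        fix u assume u: "u \<in> K"
        show "(\<Sum>v\<in>K - {u}. if E u w \<and> E v w then 1 else 0) = (if E u w then d w - 1 else (0::real))"
        proof (cases "E u w")
          case True
          have "(\<Sum>v\<in>K - {u}. if E u w \<and> E v w then 1 else (0::real)) = real (card {v\<in>K - {u}. E v w})"
            using True D(1) by (simp add: sum.inter_filter[symmetric])
          also have "{v\<in>K - {u}. E v w} = {v\<in>K. E v w} - {u}" by auto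
          also have "real (card ({v\<in>K. E v w} - {u})) = d w - 1"
            using card_Suc_Diff1[of "{v\<in>K. E v w}" u] u True D(1) by (simp add: d_def)
          finally show ?thesis using True by simp
        qed simp
      qed
      also have "\<dots> = d w * (d w - 1)"
        using D(1) by (simp add: sum.inter_filter[symmetric] d_def)
      finally show "(\<Sum>u\<in>K. \<Sum>v\<in>K - {u}. if E u w \<and> E v w then 1 else 0) = d w * (d w - 1)" .
    qed
    finally show ?thesis .
  qed
  have int: "2 * (real r - 1) * d w - real r * (real r - 1) \<le> d w * (d w - 1)" for w
  proof -
    define i where "i = int (card {u\<in>K. E u w}) - int r"
    have "i * (i + 1) \<ge> 0"
      by (cases "i \<ge> 0") (auto simp: mult_nonneg_nonneg mult_nonpos_nonpos)
    then have "real_of_int (i * (i + 1)) \<ge> 0" by (simp only: of_int_0_le_iff)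
    moreover have "real_of_int i = d w - real r" by (simp add: i_def d_def)
    ultimately show ?thesis by (simp add: algebra_simps)
  qed
  have "(real r + 1) * ((1 - 1 / real r - e) * m) = (\<Sum>u\<in>K. (1 - 1 / real r - e) * m)"
    using D(3) by simp
  also have "\<dots> \<le> (\<Sum>w\<in>W. d w)"
    unfolding deg_eq m_def by (intro sum_mono deg) (use D(2) in auto)
  finally have "2 * (real r - 1) * ((real r + 1) * ((1 - 1 / real r - e) * m)) - real r * (real r - 1) * m
     \<le> 2 * (real r - 1) * (\<Sum>w\<in>W. d w) - real r * (real r - 1) * m"
    using r by (intro diff_right_mono mult_left_mono) auto
  also have "\<dots> = (\<Sum>w\<in>W. 2 * (real r - 1) * d w - real r * (real r - 1))"
    by (simp add: sum_subtractf sum_distrib_left m_def)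
  also have "\<dots> \<le> (\<Sum>w\<in>W. d w * (d w - 1))" by (intro sum_mono int)
  also have "\<dots> = (\<Sum>u\<in>K. \<Sum>v\<in>K - {u}. real (card (common_nbrs W {u, v})))" by (simp add: codeg_eq)
  also have "\<dots> < (\<Sum>u\<in>K. \<Sum>v\<in>K - {u}. B)"
  proof (intro sum_strict_mono)
    fix u assume u: "u \<in> K"
    show "K - {u} \<noteq> {}" using D r u card_Diff_singleton[OF u] by (metis card.empty diff_Suc_1 not_numeral_le_zero)
  qed (use D lt in auto)
  also have "\<dots> = (real r + 1) * (real r * B)"
    using D by simp
  \<comment> \<open>The constant terms of both sides agree, which is where the surplus
    \<open>2 / (r^2 (r + 1))\<close> comes from. Only the terms in \<open>e\<close> differ, and they
    contradict the strict inequality.\<close>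
  finally have "2 * (real r - 1) * ((real r + 1) * (1 - 1 / real r - e)) - real r * (real r - 1)
    < (real r + 1) * (real r * ((real r - 2) / real r + 2 / (real r ^ 2 * (real r + 1)) - 2 * e))"
    (is "?L < ?R")
  proof -
    assume "2 * (real r - 1) * ((real r + 1) * ((1 - 1 / real r - e) * m)) - real r * (real r - 1) * m < (real r + 1) * (real r * B)"
    then have "m * ?L < m * ?R" unfolding B_def by (simp add: algebra_simps)
    then show ?thesis using m by simp
  qed
  moreover have "?L = real r ^ 2 - real r - 2 + 2 / real r - 2 * (real r ^ 2 - 1) * e"
    using r0 by (simp add: field_simps power2_eq_square)
  moreover have "?R = real r ^ 2 - real r - 2 + 2 / real r - 2 * (real r ^ 2 + real r) * e"
    using r0 by (simp add: divide_simps power2_eq_square) (simp add: algebra_simps)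
  moreover have "2 * (real r ^ 2 - 1) * e \<le> 2 * (real r ^ 2 + real r) * e"
    using e r0 by (intro mult_right_mono) auto
  ultimately show False by linarith
qed

text \<open>Grow cliques inside the common neighbourhood \<open>U\<close> of an edge of large
  codegree. A vertex has at most \<open>g\<close>, roughly \<open>m / r\<close>, non-neighbours, so
  an \<open>s\<close>-clique of \<open>U\<close> has about \<open>(r - 2 - s) * m / r\<close>
  extensions. At \<open>s = r - 2\<close> this main term vanishes, and the last extension rests on
  the codegree surplus alone.\<close>

lemma ex_edge_many_cliques:
  assumes W: "finite W" and r: "r \<ge> 2" and K: "cliques W (Suc r) \<noteq> {}"
    and deg: "\<And>u. u \<in> W \<Longrightarrow> real (card (nbrs W u)) \<ge> (1 - 1 / real r - 1 / (2 * real r ^ 4)) * real (card W)"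
  shows "\<exists>u\<in>W. \<exists>v\<in>W. E u v \<and> real (card {R\<in>cliques W (Suc r). u \<in> R \<and> v \<in> R}) \<ge>
     (real (card W) / real r) ^ (r - 1) * (5 / (6 * real r ^ 3))"
proof -
  define m where "m = real (card W)"
  \<comment> \<open>The loss \<open>(s + 2) * e\<close> is then at most \<open>1 / (2 r^3)\<close>,
    while the surplus is at least \<open>4 / (3 r^3)\<close>; the difference is
    \<open>5 / (6 r^3)\<close>.\<close>
  define e where "e = 1 / (2 * real r ^ 4)"
  define g where "g = (1 / real r + e) * m"
  from K obtain K where K: "K \<in> cliques W (Suc r)" by auto
  note D = cliquesD[OF W K]
  have W0: "W \<noteq> {}" using D by auto
  have m: "m > 0" using W W0 by (simp add: m_def card_gt_0_iff)
  have r0: "real r \<ge> 2" using r by simp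
  obtain u v where uv: "u \<in> K" "v \<in> K" "u \<noteq> v"
    and big: "real (card (common_nbrs W {u, v})) \<ge> ((real r - 2) / real r + 2 / (real r ^ 2 * (real r + 1)) - 2 * e) * m"
    using ex_large_codegree[OF W W0 r K, of e] deg unfolding m_def e_def by auto
  define U where "U = common_nbrs W {u, v}"
  have U: "finite U" "U \<subseteq> W" using W by (auto simp: U_def common_nbrs_def)
  have gU: "real (card (U - nbrs U w)) \<le> g" if "w \<in> U" for w
  proof -
    have w: "w \<in> W" using that U by auto
    have "card (U - nbrs U w) \<le> card (W - nbrs W w)"
      using non_nbrs_mono[OF U(2)] W by (intro card_mono) auto
    also have "real (card (W - nbrs W w)) = m - real (card (nbrs W w))"
      using W by (subst card_Diff_subset) (auto simp: nbrs_def m_def card_mono of_nat_diff)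
    finally show ?thesis using deg[OF w] by (simp add: g_def e_def m_def algebra_simps)
  qed
  have step: "real (card U) - real s * g \<ge> m * ((real r - 2 - real s) / real r + 5 / (6 * real r ^ 3))"
    if "s \<le> r - 2" for s
  proof -
    have "real s + 2 \<le> real r" using that r by linarith
    then have "(real s + 2) * e \<le> real r * e" by (intro mult_right_mono) (auto simp: e_def)
    also have "\<dots> = 1 / (2 * real r ^ 3)" using r0 by (simp add: e_def power_def field_simps eval_nat_numeral)
    finally have 1: "(real s + 2) * e \<le> 1 / (2 * real r ^ 3)" .
    have 2: "2 / (real r ^ 2 * (real r + 1)) \<ge> 4 / (3 * real r ^ 3)"
      using r0 by (simp add: divide_simps power2_eq_square power3_eq_cube)
    have "5 / (6 * real r ^ 3) = 4 / (3 * real r ^ 3) - 1 / (2 * real r ^ 3)"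
      using r0 by (simp add: divide_simps)
    then have 3: "5 / (6 * real r ^ 3) \<le> 2 / (real r ^ 2 * (real r + 1)) - (real s + 2) * e"
      using 1 2 by linarith
    have "m * ((real r - 2 - real s) / real r + 5 / (6 * real r ^ 3)) \<le>
          m * ((real r - 2 - real s) / real r + (2 / (real r ^ 2 * (real r + 1)) - (real s + 2) * e))"
      using 3 m by (intro mult_left_mono add_left_mono) auto
    also have "\<dots> = ((real r - 2) / real r + 2 / (real r ^ 2 * (real r + 1)) - 2 * e) * m - real s * g"
      by (simp add: g_def algebra_simps diff_divide_distrib add_divide_distrib)
    also have "\<dots> \<le> real (card U) - real s * g" using big by (simp add: U_def)
    finally show ?thesis .
  qed
  have count: "real (card (cliques U s)) \<ge> real ((r - 2) choose s) * (m / real r) ^ s" if "s \<le> r - 2" for s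
    using that
  proof (induction s)
    case 0
    then show ?case using cliques_0[OF U(1)] by simp
  next
    case (Suc s)
    let ?q = "r - 2"
    have q: "real ?q = real r - 2" using r by simp
    have "real (Suc s) * (real (?q choose Suc s) * (m / real r) ^ Suc s) =
          (real (Suc s) * real (?q choose Suc s)) * ((m / real r) * (m / real r) ^ s)" by simp
    also have "\<dots> = ((real ?q - real s) * real (?q choose s)) * ((m / real r) * (m / real r) ^ s)"
      by (subst real_binomial_Suc) (use Suc.prems in auto)
    also have "\<dots> = (real (?q choose s) * (m / real r) ^ s) * (m * ((real r - 2 - real s) / real r))"
      unfolding q by simp
    also have "\<dots> \<le> real (card (cliques U s)) * (real (card U) - real s * g)"
    proof (rule mult_mono)
      have "m * ((real r - 2 - real s) / real r) \<le> m * ((real r - 2 - real s) / real r + 5 / (6 * real r ^ 3))"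
        using m by (intro mult_left_mono) auto
      then show "m * ((real r - 2 - real s) / real r) \<le> real (card U) - real s * g"
        using step[of s] Suc.prems by simp
      show "0 \<le> m * ((real r - 2 - real s) / real r)" using m Suc.prems by simp
    qed (use Suc in auto)
    also have "\<dots> \<le> real (Suc s) * real (card (cliques U (Suc s)))"
      by (rule card_cliques_Suc_ge[OF U(1) gU])
    finally show ?case by (simp only: mult_le_cancel_left_pos of_nat_0_less_iff zero_less_Suc)
  qed
  have S: "Suc (r - 2) = r - 1" using r by simp
  have "(m / real r) ^ (r - 2) * (m * (5 / (6 * real r ^ 3))) \<le> real (card (cliques U (r - 2))) * (real (card U) - real (r - 2) * g)"
  proof (rule mult_mono)
    show "(m / real r) ^ (r - 2) \<le> real (card (cliques U (r - 2)))" using count[of "r - 2"] by simp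
    show "m * (5 / (6 * real r ^ 3)) \<le> real (card U) - real (r - 2) * g"
      using step[of "r - 2"] r by simp
  qed (use m in auto)
  also have "\<dots> \<le> real (r - 1) * real (card (cliques U (r - 1)))"
    using card_cliques_Suc_ge[OF U(1) gU, of "r - 2"] unfolding S by simp
  \<comment> \<open>Dividing by \<open>r\<close> instead of \<open>r - 1\<close> completes the power
    of \<open>m / r\<close> to the exponent \<open>r - 1\<close>.\<close>
  also have "\<dots> \<le> real r * real (card (cliques U (r - 1)))" by (intro mult_right_mono) auto
  finally have "(m / real r) ^ (r - 2) * (m * (5 / (6 * real r ^ 3))) / real r \<le> real (card (cliques U (r - 1)))"
    using r0 pos_divide_le_eq[of "real r"] by (metis mult.commute less_le_trans zero_less_numeral)
  also have "(m / real r) ^ (r - 2) * (m * (5 / (6 * real r ^ 3))) / real r = (m / real r) ^ (r - 1) * (5 / (6 * real r ^ 3))"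
    unfolding S[symmetric] by (simp add: field_simps)
  also have "card (cliques U (r - 1)) \<le> card {R\<in>cliques W (Suc r). u \<in> R \<and> v \<in> R}"
  proof (rule card_inj_on_le[where f = "\<lambda>Q. insert u (insert v Q)"])
    have notin: "u \<notin> Q" "v \<notin> Q" if "Q \<in> cliques U (r - 1)" for Q
      using cliquesD(2)[OF U(1) that] irrefl by (auto simp: U_def common_nbrs_def)
    show "inj_on (\<lambda>Q. insert u (insert v Q)) (cliques U (r - 1))"
      by (rule inj_on_inverseI[where g = "\<lambda>S. S - {u, v}"]) (use notin in auto)
    have Euv: "E u v" using D(4) uv by (auto simp: pairwise_def)
    show "(\<lambda>Q. insert u (insert v Q)) ` cliques U (r - 1) \<subseteq> {R\<in>cliques W (Suc r). u \<in> R \<and> v \<in> R}"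
    proof safe
      fix Q assume Q: "Q \<in> cliques U (r - 1)"
      have QW: "Q \<in> cliques W (r - 1)" using Q cliques_mono[OF U(2)] by auto
      have v: "v \<in> common_nbrs W Q"
        using cliquesD(2)[OF U(1) Q] D(2) uv sym by (auto simp: U_def common_nbrs_def)
      note 1 = insert_cliques[OF W QW v]
      have "u \<in> common_nbrs W (insert v Q)"
        using cliquesD(2)[OF U(1) Q] D(2) uv sym Euv by (auto simp: U_def common_nbrs_def)
      then have "insert u (insert v Q) \<in> cliques W (Suc (Suc (r - 1)))" by (rule insert_cliques[OF W 1(1)])
      then show "insert u (insert v Q) \<in> cliques W (Suc r)" using r by simp
    qed
    show "finite {R\<in>cliques W (Suc r). u \<in> R \<and> v \<in> R}" using W by simp
  qed
  finally have "(m / real r) ^ (r - 1) * (5 / (6 * real r ^ 3)) \<le> real (card {R\<in>cliques W (Suc r). u \<in> R \<and> v \<in> R})"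
    by simp
  moreover have "u \<in> W" "v \<in> W" "E u v" using D uv by (auto simp: pairwise_def)
  ultimately show ?thesis unfolding m_def by blast
qed

text \<open>Greedy choice of one vertex from each \<open>N v\<close>. Every vertex of the current
  clique excludes at most \<open>t\<close> elements of \<open>N v\<close>, and by \<open>At\<close>
  a newly chosen vertex keeps this property for the other sets. Each step moves one unit from
  \<open>card I\<close> to \<open>q\<close>, so the requirement \<open>(q + card I - 1) * t\<close>
  stays the same throughout.\<close>

lemma extend_clique_transversal:
  fixes t :: real
  assumes V: "finite V" and t: "t \<ge> 0" and "finite I"
    and A: "\<And>v. v \<in> I \<Longrightarrow> A v \<subseteq> V" "\<And>v v'. v \<in> I \<Longrightarrow> v' \<in> I \<Longrightarrow> v \<noteq> v' \<Longrightarrow> A v \<inter> A v' = {}"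
    and At: "\<And>v w. v \<in> I \<Longrightarrow> w \<in> A v \<Longrightarrow> real (card (V - nbrs V w - A v)) \<le> t"
    and N: "\<And>v. v \<in> I \<Longrightarrow> N v \<subseteq> A v"
    and Q: "Q \<in> cliques V q" "\<And>w v. w \<in> Q \<Longrightarrow> v \<in> I \<Longrightarrow> real (card (A v - nbrs V w)) \<le> t"
    and big: "\<And>v. v \<in> I \<Longrightarrow> real (card (N v)) > (real q + real (card I) - 1) * t"
  shows "\<exists>Q'\<in>cliques V (q + card I). Q' \<subseteq> Q \<union> (\<Union>v\<in>I. N v)"
  using \<open>finite I\<close> A At N Q big
proof (induction I arbitrary: q Q rule: finite_induct)
  case empty
  then show ?case by auto
next
  case (insert v I)
  note D = cliquesD[OF V insert.prems(5)]
  have Nv: "finite (N v)" using insert.prems(1,4) V by (meson finite_subset insertI1)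
  have "real (card (\<Union>w\<in>Q. A v - nbrs V w)) \<le> real (\<Sum>w\<in>Q. card (A v - nbrs V w))"
    by (subst of_nat_le_iff) (use D in \<open>intro card_UN_le; auto\<close>)
  also have "\<dots> \<le> (\<Sum>w\<in>Q. t)" unfolding of_nat_sum by (intro sum_mono insert.prems) auto
  also have "\<dots> = real q * t" using D by simp
  also have "\<dots> \<le> (real q + real (card (insert v I)) - 1) * t"
    using t insert.hyps by (intro mult_right_mono) auto
  also have "\<dots> < real (card (N v))" using insert.prems(7)[of v] by simp
  finally have "card (\<Union>w\<in>Q. A v - nbrs V w) < card (N v)" by simp
  moreover have "finite (\<Union>w\<in>Q. A v - nbrs V w)"
    using D(1) V insert.prems(1) by (meson finite_Diff finite_UN finite_subset insertI1)
  ultimately have "\<not> N v \<subseteq> (\<Union>w\<in>Q. A v - nbrs V w)"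
    by (meson card_mono linorder_not_less)
  then obtain z where z: "z \<in> N v" "z \<notin> (\<Union>w\<in>Q. A v - nbrs V w)" by auto
  have zA: "z \<in> A v" using z insert.prems(4) by auto
  have zc: "z \<in> common_nbrs V Q" using z zA insert.prems(1) by (auto simp: common_nbrs_def nbrs_def)
  note ins = insert_cliques[OF V insert.prems(5) zc]
  have "\<exists>Q'\<in>cliques V (Suc q + card I). Q' \<subseteq> insert z Q \<union> (\<Union>v\<in>I. N v)"
  proof (rule insert.IH)
    show "insert z Q \<in> cliques V (Suc q)" by (rule ins)
    fix w v' assume w: "w \<in> insert z Q" and v': "v' \<in> I"
    show "real (card (A v' - nbrs V w)) \<le> t"
    proof (cases "w = z")
      case True
      have "A v \<inter> A v' = {}" using insert.prems(2)[of v v'] v' insert.hyps by auto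
      then have "A v' - nbrs V w \<subseteq> V - nbrs V z - A v" using True insert.prems(1) v' by auto
      then have "card (A v' - nbrs V w) \<le> card (V - nbrs V z - A v)" using V by (intro card_mono) auto
      also have "real \<dots> \<le> t" using insert.prems(3)[of v z] zA by simp
      finally show ?thesis by simp
    qed (use insert.prems(6) w v' in auto)
  next
    fix v' assume "v' \<in> I"
    then show "(real (Suc q) + real (card I) - 1) * t < real (card (N v'))"
      using insert.prems(7)[of v'] insert.hyps by (simp add: algebra_simps)
  next
    fix v1 v2 assume "v1 \<in> I" "v2 \<in> I" "v1 \<noteq> v2"
    then show "A v1 \<inter> A v2 = {}" using insert.prems(2) by simp
  qed (use insert.prems(1,3,4) in auto)
  then show ?case using z(1) insert.hyps by (auto simp: subset_iff) 
qed

text \<open>Starting from an \<open>r\<close>-clique \<open>R\<close>, almost every vertex lies in one of the sets \<open>A v\<close> of vertices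
  adjacent to all of \<open>R\<close> but \<open>v\<close>. A vertex with neighbours in every \<open>A v\<close>, or an edge between two
  vertices without neighbours in the same \<open>A v\<close>, extends greedily to an \<open>(r+1)\<close>-clique.\<close>

lemma colourable_of_min_degree:
  assumes V: "finite V" "V \<noteq> {}" and r: "r \<ge> 2" and free: "cliques V (Suc r) = {}"
    and deg: "\<And>u. u \<in> V \<Longrightarrow> real (card (nbrs V u)) \<ge> (1 - 1 / real r - 1 / (2 * real r ^ 4)) * real (card V)"
  shows "\<exists>c :: 'a \<Rightarrow> nat. (\<forall>u\<in>V. c u < r) \<and> (\<forall>u\<in>V. \<forall>v\<in>V. E u v \<longrightarrow> c u \<noteq> c v)"
proof -
  define m where "m = real (card V)"
  define e where "e = 1 / (2 * real r ^ 4)"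
  define g where "g = (1 / real r + e) * m"
  define non where "non u = V - nbrs V u" for u
  have m: "m > 0" using V by (simp add: m_def card_gt_0_iff)
  have r0: "real r \<ge> 2" using r by simp
  have e0: "e > 0" using r0 by (simp add: e_def)
  have non_le: "real (card (non u)) \<le> g" if "u \<in> V" for u
  proof -
    have "real (card (non u)) = m - real (card (nbrs V u))"
      unfolding non_def using V by (subst card_Diff_subset) (auto simp: nbrs_def m_def card_mono of_nat_diff)
    then show ?thesis using deg[OF that] by (simp add: g_def e_def m_def algebra_simps)
  qed
  have re: "real r ^ 2 * e \<le> 1 / 8"
    using r0 power_mono[OF r0, of 2] by (simp add: e_def divide_simps power2_eq_square eval_nat_numeral)
  have ex: "cliques V s \<noteq> {}" if "s \<le> r" for s
    using that
  proof (induction s)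
    case 0
    then show ?case using cliques_0 V by simp
  next
    case (Suc s)
    then obtain T where T: "T \<in> cliques V s" by auto
    note D = cliquesD[OF V(1) T]
    have "m \<le> real (card (common_nbrs V T)) + real s * g"
      unfolding m_def using card_le_common_nbrs[OF V(1) D(1), of g] non_le D unfolding non_def by auto
    moreover have "real s * g < m"
    proof -
      have "real s * (1 / real r + e) \<le> (real r - 1) * (1 / real r + e)"
        using Suc.prems e0 by (intro mult_right_mono) auto
      also have "\<dots> = 1 - 1 / real r + (real r - 1) * e" using r0 by (simp add: field_simps)
      also have "\<dots> < 1"
      proof -
        have "(real r * (real r - 1)) * e \<le> real r ^ 2 * e"
          using e0 r0 by (intro mult_right_mono) (auto simp: power2_eq_square)
        then have "real r * ((real r - 1) * e) < 1" using re by (simp add: mult.assoc)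
        then show ?thesis using r0 by (simp add: field_simps)
      qed
      finally have "m * (real s * (1 / real r + e)) < m * 1" using m by (intro mult_strict_left_mono) auto
      then show ?thesis by (simp add: g_def mult_ac)
    qed
    ultimately have "card (common_nbrs V T) > 0" by linarith
    then obtain w where "w \<in> common_nbrs V T" by fastforce
    then show ?case using insert_cliques[OF V(1) T] by auto
  qed
  then obtain R where R: "R \<in> cliques V r" by blast
  note D = cliquesD[OF V(1) R]
  define A where "A v = {w\<in>V. \<not> E v w \<and> (\<forall>u\<in>R - {v}. E u w)}" for v
  define B where "B = V - (\<Union>v\<in>R. A v)"
  have fA: "finite (A v)" "A v \<subseteq> V" for v using V by (auto simp: A_def)
  have disj: "A v \<inter> A v' = {}" if "v \<in> R" "v' \<in> R" "v \<noteq> v'" for v v'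
    using that by (auto simp: A_def)
  have no_common: "common_nbrs V R = {}" using insert_cliques[OF V(1) R] free by auto
  have noK: False if "Q \<in> cliques V (Suc r)" for Q using that free by auto
  \<comment> \<open>Exchanging \<open>v\<close> for both ends of an edge inside \<open>A v\<close>
    would turn \<open>R\<close> into an \<open>(r + 1)\<close>-clique.\<close>
  have indep: "\<not> E x y" if "v \<in> R" "x \<in> A v" "y \<in> A v" for v x y
  proof
    assume xy: "E x y"
    obtain r' where r': "r = Suc r'" using r by (cases r) auto
    have 1: "R - {v} \<in> cliques V r'" by (rule remove_cliques) (use V R r' that in auto)
    have x: "x \<in> common_nbrs V (R - {v})" using that by (auto simp: A_def common_nbrs_def)
    have y: "y \<in> common_nbrs V (insert x (R - {v}))" using that xy by (auto simp: A_def common_nbrs_def)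
    from insert_cliques(1)[OF V(1) insert_cliques(1)[OF V(1) 1 x] y] show False using noK r' by simp
  qed
  have Ag: "real (card (A v)) \<le> g" if "v \<in> R" for v
  proof -
    have "card (A v) \<le> card (non v)" using V by (intro card_mono) (auto simp: A_def non_def nbrs_def)
    then show ?thesis using non_le[of v] that D by force
  qed
  have cardA: "(\<Sum>v\<in>R. real (card (A v))) + real (card B) = m"
  proof -
    have "card V = card (\<Union>v\<in>R. A v) + card B"
      using V fA D(1) by (subst card_Un_disjoint[symmetric]) (auto simp: B_def intro!: arg_cong[where f = card])
    also have "card (\<Union>v\<in>R. A v) = (\<Sum>v\<in>R. card (A v))"
      using D(1) fA disj by (intro card_UN_disjoint) auto
    finally show ?thesis by (simp add: m_def)
  qed
  \<comment> \<open>Count non-adjacent pairs between \<open>V\<close> and \<open>R\<close>. Every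
    vertex misses some element of \<open>R\<close>, since none extends it, and a vertex of
    \<open>B\<close> misses at least two; each element of \<open>R\<close> has at most
    \<open>g\<close> non-neighbours, itself included.\<close>
  have B_le: "real (card B) \<le> real r * e * m"
  proof -
    have cnt: "(if w \<in> B then 2 else 1) \<le> card {v\<in>R. \<not> E v w}" if w: "w \<in> V" for w
    proof -
      obtain v where v: "v \<in> R" "\<not> E v w" using no_common w by (auto simp: common_nbrs_def)
      show ?thesis
      proof (cases "w \<in> B")
        case True
        then have "w \<notin> A v" using v by (auto simp: B_def)
        then obtain u where u: "u \<in> R" "u \<noteq> v" "\<not> E u w" using v w by (auto simp: A_def)
        then have "card {u, v} \<le> card {v\<in>R. \<not> E v w}" using D(1) v by (intro card_mono) auto
        then show ?thesis using u True by simp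
      next
        case False
        have "card {v} \<le> card {v\<in>R. \<not> E v w}" using D(1) v by (intro card_mono) auto
        then show ?thesis using False by simp
      qed
    qed
    have BV: "B \<subseteq> V" by (auto simp: B_def)
    have "m + real (card B) = (\<Sum>w\<in>V. 1 + (if w \<in> B then 1 else 0))"
      using V(1) BV by (simp add: sum.distrib m_def Int_absorb1 sum.If_cases)
    also have "\<dots> \<le> (\<Sum>w\<in>V. real (card {v\<in>R. \<not> E v w}))"
    proof (rule sum_mono)
      fix w assume "w \<in> V"
      from cnt[OF this] show "1 + (if w \<in> B then 1 else 0) \<le> real (card {v\<in>R. \<not> E v w})"
        by (cases "w \<in> B") auto
    qed
    also have "\<dots> = (\<Sum>w\<in>V. \<Sum>v\<in>R. if \<not> E v w then 1 else 0)"
      using D(1) by (simp only: sum.inter_filter[symmetric]) simp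
    also have "\<dots> = (\<Sum>v\<in>R. \<Sum>w\<in>V. if \<not> E v w then 1 else 0)" by (rule sum.swap)
    also have "\<dots> = (\<Sum>v\<in>R. real (card (non v)))"
    proof (rule sum.cong[OF refl])
      fix v
      have "non v = {w\<in>V. \<not> E v w}" by (auto simp: non_def nbrs_def)
      then show "(\<Sum>w\<in>V. if \<not> E v w then 1 else 0) = real (card (non v))"
        using V(1) by (simp only: sum.inter_filter[symmetric]) simp
    qed
    also have "\<dots> \<le> (\<Sum>v\<in>R. g)" using D by (intro sum_mono non_le) auto
    also have "\<dots> = m + real r * e * m" using D(3) r0 by (simp add: g_def field_simps)
    finally show ?thesis by simp
  qed
  \<comment> \<open>The sets \<open>A v\<close> have size at most \<open>g\<close> and total at
    least \<open>m - r * e * m\<close>, so each has size at least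
    \<open>m / r - (2 * r - 1) * e * m\<close>. This is \<open>g - t\<close>.\<close>
  define t where "t = 2 * real r * e * m"
  have t0: "t \<ge> 0" using e0 m by (simp add: t_def)
  have two: "real (card (A v)) + real (card (A v')) \<ge> g + (m / real r - (2 * real r - 1) * e * m)"
    if "v \<in> R" "v' \<in> R" "v \<noteq> v'" for v v'
  proof -
    have "(\<Sum>u\<in>R. real (card (A u))) = real (card (A v)) + (real (card (A v')) + (\<Sum>u\<in>R - {v} - {v'}. real (card (A u))))"
      using D(1) that by (simp add: sum.remove[of R v] sum.remove[of "R - {v}" v'])
    also have "(\<Sum>u\<in>R - {v} - {v'}. real (card (A u))) \<le> (\<Sum>u\<in>R - {v} - {v'}. g)"
      by (intro sum_mono Ag) auto
    also have "\<dots> = (real r - 2) * g" using D that r by (simp add: of_nat_diff)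
    finally have "real (card (A v)) + real (card (A v')) \<ge> m - real (card B) - (real r - 2) * g"
      using cardA by linarith
    then have "real (card (A v)) + real (card (A v')) \<ge> m - real r * e * m - (real r - 2) * g"
      using B_le by linarith
    moreover have "m - real r * e * m - (real r - 2) * g = g + (m / real r - (2 * real r - 1) * e * m)"
      using r0 by (simp add: g_def field_simps)
    ultimately show ?thesis by linarith
  qed
  have one: "real (card (A v)) \<ge> m / real r - (2 * real r - 1) * e * m" if "v \<in> R" for v
  proof -
    have "R \<noteq> {v}" using D(3) r by auto
    then obtain v' where "v' \<in> R" "v \<noteq> v'" using \<open>v \<in> R\<close> by auto
    then show ?thesis using two[OF that, of v'] Ag[of v'] by linarith
  qed
  have gt: "g - real (card (A v)) \<le> t" if "v \<in> R" for v
    using one[OF that] by (simp add: g_def t_def algebra_simps)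
  have outside: "real (card (non x - A v)) \<le> t" if "v \<in> R" "x \<in> V" "A v \<subseteq> non x" for v x
  proof -
    have "real (card (non x - A v)) = real (card (non x)) - real (card (A v))"
      using that(3) fA card_mono[OF _ that(3)] V by (simp add: card_Diff_subset of_nat_diff non_def)
    then show ?thesis using gt[OF that(1)] non_le[OF that(2)] by linarith
  qed
  have Anon: "A v \<subseteq> non x" if "v \<in> R" "x \<in> A v" for v x
    using indep[OF that] fA by (auto simp: non_def nbrs_def)
  have miss: "A v' - nbrs V x \<subseteq> non x - A v" if "v \<in> R" "v' \<in> R" "v \<noteq> v'" for v v' x
    using disj[OF that] fA by (auto simp: non_def)
  have miss_le: "real (card (A v' - nbrs V x)) \<le> t"
    if "v \<in> R" "v' \<in> R" "v \<noteq> v'" "x \<in> V" "A v \<subseteq> non x" for v v' x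
  proof -
    have "card (A v' - nbrs V x) \<le> card (non x - A v)"
      using miss[OF that(1-3)] V by (intro card_mono) (auto simp: non_def)
    then show ?thesis using outside[OF that(1,4,5)] by linarith
  qed
  \<comment> \<open>\<open>poly1\<close> and \<open>poly2\<close> are the size conditions of the two
    greedy extensions: half of \<open>m / r - (2 * r - 1) * e * m\<close> must exceed
    \<open>(r - 1) * t\<close>, respectively all of it must exceed \<open>r * t\<close>.\<close>
  have poly1: "(4 * real r ^ 2 - 2 * real r - 1) * e < 1 / real r"
  proof -
    have "2 * real r ^ 2 * (real r - 1) ^ 2 + real r > 0" using r0 by (intro add_nonneg_pos) auto
    then show ?thesis using r0 by (simp add: e_def divide_simps) (simp add: algebra_simps power2_eq_square eval_nat_numeral)
  qed
  have poly2: "(2 * real r ^ 2 + 2 * real r - 1) * e < 1 / real r"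
  proof -
    have "2 * real r ^ 3 * (real r - 2) + 2 * real r ^ 2 * (real r - 1) + real r > 0"
      using r0 by (intro add_nonneg_pos add_nonneg_nonneg mult_nonneg_nonneg) auto
    then show ?thesis using r0 by (simp add: e_def divide_simps) (simp add: algebra_simps power2_eq_square eval_nat_numeral)
  qed
  have "\<exists>v\<in>R. A v \<subseteq> non x" if x: "x \<in> V" for x
  proof (rule ccontr)
    assume "\<not> ?thesis"
    then have meets: "A v \<inter> nbrs V x \<noteq> {}" if "v \<in> R" for v
      using that fA(2)[of v] unfolding non_def by blast
    define N where "N v = A v \<inter> nbrs V x" for v
    have "R \<noteq> {}" using D r by auto
    \<comment> \<open>Non-neighbours of \<open>x\<close> in \<open>A v0\<close> and
      \<open>A v\<close> together number at most \<open>g\<close>, which bounds the sum of the sizes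
      of \<open>N v0\<close> and \<open>N v\<close> from below. As \<open>N v0\<close> is the
      smallest, every other \<open>N v\<close> has at least half of that bound; \<open>N v0\<close>
      itself only has to supply one vertex.\<close>
    then obtain v0 where v0: "v0 \<in> R" and min: "\<And>v. v \<in> R \<Longrightarrow> card (N v0) \<le> card (N v)"
      using arg_min_if_finite[OF D(1), of "\<lambda>v. card (N v)"] by (metis linorder_not_less)
    obtain w where w: "w \<in> N v0" using meets[OF v0] by (auto simp: N_def)
    have wA: "w \<in> A v0" using w by (simp add: N_def)
    have bigN: "real (card (N v)) > (real 1 + real (card (R - {v0})) - 1) * t" if v: "v \<in> R - {v0}" for v
    proof -
      have split: "real (card (A u)) = real (card (N u)) + real (card (A u - nbrs V x))" for u
        unfolding N_def of_nat_add[symmetric] of_nat_eq_iff using fA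
        by (subst card_Un_disjoint[symmetric]) (auto intro!: arg_cong[where f = card])
      have "card (A v0 - nbrs V x) + card (A v - nbrs V x) \<le> card (non x)"
        using disj[OF v0, of v] v fA V
        by (subst card_Un_disjoint[symmetric]) (auto simp: non_def intro!: card_mono)
      then have "real (card (A v0 - nbrs V x)) + real (card (A v - nbrs V x)) \<le> g"
        using non_le[OF x] by linarith
      then have "real (card (N v0)) + real (card (N v)) \<ge> m / real r - (2 * real r - 1) * e * m"
        using two[OF v0, of v] v split[of v0] split[of v] by auto
      moreover have "real (card (N v0)) \<le> real (card (N v))" using min v by simp
      ultimately have "2 * real (card (N v)) \<ge> m / real r - (2 * real r - 1) * e * m" by linarith
      moreover have "m / real r - (2 * real r - 1) * e * m > 2 * ((real r - 1) * t)"
      proof -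
        have "m * ((4 * real r ^ 2 - 2 * real r - 1) * e) < m * (1 / real r)"
          using poly1 m by (intro mult_strict_left_mono) auto
        then show ?thesis by (simp add: t_def algebra_simps power2_eq_square)
      qed
      moreover have "real 1 + real (card (R - {v0})) - 1 = real r - 1"
        using D v0 r by (simp add: of_nat_diff)
      ultimately show ?thesis by simp
    qed
    have "\<exists>Q'\<in>cliques V (1 + card (R - {v0})). Q' \<subseteq> {w} \<union> (\<Union>v\<in>R - {v0}. N v)"
    proof (rule extend_clique_transversal[where A = A and t = t])
      show "{w} \<in> cliques V 1" using wA fA by (auto simp: cliques_def)
    next
      fix w' v assume "w' \<in> {w}" "v \<in> R - {v0}"
      then show "real (card (A v - nbrs V w')) \<le> t"
        using miss_le[OF v0, of v w'] Anon[OF v0 wA] wA fA by auto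
    next
      fix v w' assume "v \<in> R - {v0}" "w' \<in> A v"
      then show "real (card (V - nbrs V w' - A v)) \<le> t"
        using outside[of v w'] Anon[of v w'] fA by (auto simp: non_def)
    qed (use V t0 D fA disj bigN in \<open>auto simp: N_def\<close>)
    then obtain Q' where Q': "Q' \<in> cliques V r" "Q' \<subseteq> {w} \<union> (\<Union>v\<in>R - {v0}. N v)"
      using D v0 r by auto
    then have "x \<in> common_nbrs V Q'" using w x sym by (auto simp: common_nbrs_def N_def nbrs_def)
    then show False using insert_cliques[OF V(1) Q'(1)] noK by blast
  qed
  then obtain \<phi> where \<phi>: "\<And>x. x \<in> V \<Longrightarrow> \<phi> x \<in> R \<and> A (\<phi> x) \<subseteq> non x" by metis
  have proper: "\<phi> x \<noteq> \<phi> y" if xy: "x \<in> V" "y \<in> V" "E x y" for x y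
  proof
    assume eq: "\<phi> x = \<phi> y"
    define v0 where "v0 = \<phi> x"
    have v0: "v0 \<in> R" "A v0 \<subseteq> non x" "A v0 \<subseteq> non y" using \<phi>[OF xy(1)] \<phi>[OF xy(2)] eq by (auto simp: v0_def)
    have neq: "x \<noteq> y" using xy(3) irrefl by auto
    have "\<exists>Q'\<in>cliques V (2 + card (R - {v0})). Q' \<subseteq> {x, y} \<union> (\<Union>v\<in>R - {v0}. A v)"
    proof (rule extend_clique_transversal[where A = A and t = t])
      show "{x, y} \<in> cliques V 2" using xy neq sym by (auto simp: cliques_def pairwise_def)
    next
      fix w' v assume "w' \<in> {x, y}" "v \<in> R - {v0}"
      then show "real (card (A v - nbrs V w')) \<le> t"
        using miss_le[OF v0(1), of v w'] v0 xy by auto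
    next
      fix v w' assume "v \<in> R - {v0}" "w' \<in> A v"
      then show "real (card (V - nbrs V w' - A v)) \<le> t"
        using outside[of v w'] Anon[of v w'] fA by (auto simp: non_def)
    next
      fix v assume v: "v \<in> R - {v0}"
      have "m * ((2 * real r ^ 2 + 2 * real r - 1) * e) < m * (1 / real r)"
        using poly2 m by (intro mult_strict_left_mono) auto
      then have "real r * t < m / real r - (2 * real r - 1) * e * m"
        by (simp add: t_def algebra_simps power2_eq_square)
      also have "\<dots> \<le> real (card (A v))" using one v by auto
      finally show "(real 2 + real (card (R - {v0})) - 1) * t < real (card (A v))"
        using D v0(1) r by (simp add: of_nat_diff)
    qed (use V t0 D fA disj in auto)
    moreover have "2 + card (R - {v0}) = Suc r" using D v0(1) r by simp
    ultimately show False using noK by auto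
  qed
  obtain h :: "'a \<Rightarrow> nat" where h: "bij_betw h R {0..<card R}" using ex_bij_betw_finite_nat[OF D(1)] by auto
  show ?thesis
  proof (intro exI[of _ "\<lambda>x. h (\<phi> x)"] conjI ballI impI)
    fix x assume "x \<in> V"
    then show "h (\<phi> x) < r" using \<phi> bij_betwE[OF h] D(3) by auto
  next
    fix x y assume "x \<in> V" "y \<in> V" "E x y"
    then show "h (\<phi> x) \<noteq> h (\<phi> y)" using proper \<phi> h by (metis bij_betw_def inj_onD)
  qed
qed

section \<open>The largest eigenvalue\<close>

lemma adj_form_cong: "(\<And>v. v \<in> V \<Longrightarrow> x v = z v) \<Longrightarrow> adj_form V x = adj_form V z"
  unfolding adj_form_def by (intro sum.cong refl) (auto simp: nbrs_def)

lemma adj_form_eq: "adj_form V x = (\<Sum>u\<in>V. \<Sum>v\<in>V. if E u v then x u * x v else 0)" if "finite V"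
  unfolding adj_form_def nbrs_def using that by (simp add: sum.inter_filter)

lemma adj_form_remove:
  assumes "finite V" "w \<in> V"
  shows "adj_form V x = adj_form (V - {w}) x + 2 * x w * (\<Sum>v\<in>nbrs V w. x v)"
proof -
  let ?W = "V - {w}" and ?f = "\<lambda>u v. if E u v then x u * x v else 0"
  have V: "V = insert w ?W" and W: "finite ?W" "w \<notin> ?W" using assms by auto
  have nb: "nbrs V w = {v\<in>?W. E w v}" using irrefl by (auto simp: nbrs_def)
  have "adj_form V x = (\<Sum>v\<in>V. ?f w v) + (\<Sum>u\<in>?W. \<Sum>v\<in>V. ?f u v)"
    unfolding adj_form_eq[OF assms(1)] by (rule sum.remove[OF assms])
  also have "(\<Sum>v\<in>V. ?f w v) = ?f w w + (\<Sum>v\<in>?W. ?f w v)" by (rule sum.remove[OF assms])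
  also have "(\<Sum>u\<in>?W. \<Sum>v\<in>V. ?f u v) = (\<Sum>u\<in>?W. ?f u w + (\<Sum>v\<in>?W. ?f u v))"
    by (intro sum.cong refl sum.remove[OF assms])
  also have "\<dots> = (\<Sum>u\<in>?W. ?f u w) + adj_form ?W x"
    unfolding adj_form_eq[OF W(1)] by (rule sum.distrib)
  also have "(\<Sum>u\<in>?W. ?f u w) = (\<Sum>v\<in>?W. ?f w v)"
    by (intro sum.cong refl) (use sym in \<open>auto simp: mult.commute\<close>)
  also have "(\<Sum>v\<in>?W. ?f w v) = x w * (\<Sum>v\<in>nbrs V w. x v)"
    unfolding nb sum_distrib_left by (rule sum.inter_filter[OF W(1), symmetric])
  finally show ?thesis using irrefl by simp
qed

text \<open>Combines the eigenvector equation, used to estimate single entries, with the Rayleigh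
  bound, used for test vectors. The Rayleigh bound also makes \<open>l\<close> the same for all such
  pairs on \<open>V\<close>.\<close>

definition perron :: "'a set \<Rightarrow> ('a \<Rightarrow> real) \<Rightarrow> real \<Rightarrow> bool" where
  "perron V x l \<longleftrightarrow> (\<forall>v\<in>V. x v \<ge> 0) \<and> (\<Sum>v\<in>V. (x v)\<^sup>2) = 1 \<and>
     (\<forall>u\<in>V. (\<Sum>v\<in>nbrs V u. x v) = l * x u) \<and> (\<forall>z. adj_form V z \<le> l * (\<Sum>v\<in>V. (z v)\<^sup>2))"

text \<open>Compactness in the product topology. Vectors are represented by total functions
  vanishing off \<open>V\<close> with values in \<open>[0, 1]\<close> on \<open>V\<close>; this is a
  product of compact sets even if the vertex type is infinite.\<close>

lemma ex_adj_form_maximizer: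
  assumes "finite V" "V \<noteq> {}"
  shows "\<exists>x. (\<forall>v\<in>V. x v \<ge> 0) \<and> (\<Sum>v\<in>V. (x v)\<^sup>2) = 1 \<and>
    (\<forall>z. (\<forall>v\<in>V. z v \<ge> 0) \<longrightarrow> (\<Sum>v\<in>V. (z v)\<^sup>2) = 1 \<longrightarrow> adj_form V z \<le> adj_form V x)"
proof -
  define B where "B = (\<lambda>v. if v \<in> V then {0..1::real} else {0})"
  define S where "S = PiE UNIV B \<inter> {x. (\<Sum>v\<in>V. (x v)\<^sup>2) = 1}"
  have cont: "continuous_on T (\<lambda>x :: 'a \<Rightarrow> real. x v)" for T v
    by (rule continuous_on_subset[OF continuous_on_product_coordinates]) simp
  have "compactin (product_topology (\<lambda>i. euclidean) UNIV) (PiE UNIV B)"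
    by (subst compactin_PiE) (auto simp: B_def)
  then have "compact (PiE UNIV B)" by (simp add: euclidean_product_topology)
  moreover have "closed {x :: 'a \<Rightarrow> real. (\<Sum>v\<in>V. (x v)\<^sup>2) = 1}"
    by (intro closed_Collect_eq continuous_on_sum continuous_on_power continuous_on_const cont)
  ultimately have S: "compact S" unfolding S_def by (rule compact_Int_closed)
  have in_S: "(\<lambda>v. if v \<in> V then z v else 0) \<in> S"
    if z: "\<forall>v\<in>V. z v \<ge> 0" "(\<Sum>v\<in>V. (z v)\<^sup>2) = 1" for z
  proof -
    have "z v \<le> 1" if "v \<in> V" for v
    proof -
      have "(z v)\<^sup>2 \<le> (\<Sum>v\<in>V. (z v)\<^sup>2)" using that assms by (intro member_le_sum) auto
      then show ?thesis using z by (simp add: power_le_one_iff) (metis abs_le_square_iff abs_1 abs_le_D1 one_power2)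
    qed
    then show ?thesis using z by (auto simp: S_def B_def)
  qed
  obtain v0 where v0: "v0 \<in> V" using assms by auto
  have "(\<Sum>v\<in>V. (if v = v0 then 1 else 0 :: real)\<^sup>2) = 1"
    using assms v0 by (simp add: if_distrib[where f = "\<lambda>t. t\<^sup>2"] cong: if_cong)
  then have "(\<lambda>v. if v \<in> V then (if v = v0 then 1 else 0) else 0) \<in> S" by (intro in_S) auto
  then have "S \<noteq> {}" by blast
  moreover have "continuous_on S (adj_form V)"
    unfolding adj_form_def by (intro continuous_on_sum continuous_on_mult cont)
  ultimately obtain x where x: "x \<in> S" "\<And>z. z \<in> S \<Longrightarrow> adj_form V z \<le> adj_form V x"
    using continuous_attains_sup[OF S] by blast
  show ?thesis
  proof (intro exI[of _ x] conjI allI impI)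
    show "\<forall>v\<in>V. x v \<ge> 0"
    proof
      fix v assume "v \<in> V"
      moreover have "x v \<in> B v" using x(1) by (auto simp: S_def)
      ultimately show "x v \<ge> 0" by (simp add: B_def)
    qed
    show "(\<Sum>v\<in>V. (x v)\<^sup>2) = 1" using x(1) by (simp add: S_def)
    fix z :: "'a \<Rightarrow> real" assume "\<forall>v\<in>V. z v \<ge> 0" "(\<Sum>v\<in>V. (z v)\<^sup>2) = 1"
    from x(2)[OF in_S[OF this]] show "adj_form V z \<le> adj_form V x"
      by (subst adj_form_cong[where z = "\<lambda>v. if v \<in> V then z v else 0"]) auto
  qed
qed

text \<open>Taking absolute values does not decrease the form, so the nonnegative maximizer gives
  the Rayleigh bound for all vectors. Varying a single coordinate then yields the eigenvector
  equation.\<close>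

lemma ex_perron:
  assumes "finite V" "V \<noteq> {}"
  shows "\<exists>l x. perron V x l"
proof -
  obtain x where x: "\<forall>v\<in>V. x v \<ge> 0" "(\<Sum>v\<in>V. (x v)\<^sup>2) = 1"
    and max: "\<And>z. \<forall>v\<in>V. z v \<ge> 0 \<Longrightarrow> (\<Sum>v\<in>V. (z v)\<^sup>2) = 1 \<Longrightarrow> adj_form V z \<le> adj_form V x"
    using ex_adj_form_maximizer[OF assms] by blast
  define l where "l = adj_form V x"
  have bound: "adj_form V z \<le> l * (\<Sum>v\<in>V. (z v)\<^sup>2)" for z
  proof (cases "(\<Sum>v\<in>V. (z v)\<^sup>2) = 0")
    case True
    then have "\<forall>v\<in>V. z v = 0" using assms by (simp add: sum_nonneg_eq_0_iff)
    then have "adj_form V z = 0" by (simp add: adj_form_def)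
    then show ?thesis using True by simp
  next
    case False
    define N where "N = (\<Sum>v\<in>V. (z v)\<^sup>2)"
    have N: "N > 0" using False by (simp add: N_def sum_nonneg less_le)
    define y where "y v = \<bar>z v\<bar> / sqrt N" for v
    have "(\<Sum>v\<in>V. (y v)\<^sup>2) = (\<Sum>v\<in>V. (z v)\<^sup>2) / N"
      using N by (simp add: y_def power_divide sum_divide_distrib)
    then have "adj_form V y \<le> l" unfolding l_def using N by (intro max) (auto simp: y_def N_def)
    moreover have "adj_form V y = adj_form V (\<lambda>v. \<bar>z v\<bar>) / N"
      unfolding adj_form_def y_def sum_divide_distrib using N
      by (intro sum.cong refl) (simp add: real_sqrt_mult_self)
    moreover have "adj_form V z \<le> adj_form V (\<lambda>v. \<bar>z v\<bar>)"
      unfolding adj_form_def by (intro sum_mono) (simp add: abs_mult[symmetric])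
    ultimately show ?thesis using N by (simp add: N_def[symmetric] pos_divide_le_eq)
  qed
  have "(\<Sum>v\<in>nbrs V w. x v) = l * x w" if w: "w \<in> V" for w
  proof -
    define c where "c = 2 * ((\<Sum>v\<in>nbrs V w. x v) - l * x w)"
    have quad: "t * c \<le> l * t\<^sup>2" for t
    proof -
      let ?z = "x(w := x w + t)"
      have nb: "(\<Sum>v\<in>nbrs V w. ?z v) = (\<Sum>v\<in>nbrs V w. x v)"
        using irrefl by (intro sum.cong refl) (auto simp: nbrs_def)
      have "adj_form V ?z = adj_form (V - {w}) ?z + 2 * (x w + t) * (\<Sum>v\<in>nbrs V w. x v)"
        using adj_form_remove[OF assms(1) w, of ?z] nb by simp
      also have "adj_form (V - {w}) ?z = adj_form (V - {w}) x" by (rule adj_form_cong) auto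
      also have "adj_form (V - {w}) x + 2 * (x w + t) * (\<Sum>v\<in>nbrs V w. x v) = l + 2 * t * (\<Sum>v\<in>nbrs V w. x v)"
        using adj_form_remove[OF assms(1) w, of x] by (simp add: l_def algebra_simps)
      finally have 1: "adj_form V ?z = l + 2 * t * (\<Sum>v\<in>nbrs V w. x v)" .
      have "(\<Sum>v\<in>V. (?z v)\<^sup>2) = (x w + t)\<^sup>2 + (\<Sum>v\<in>V - {w}. (x v)\<^sup>2)"
        by (subst sum.remove[OF assms(1) w]) (auto intro!: sum.cong)
      also have "\<dots> = 1 + 2 * t * x w + t\<^sup>2"
        using sum.remove[OF assms(1) w, of "\<lambda>v. (x v)\<^sup>2"] x(2) by (simp add: power2_sum)
      finally have "(\<Sum>v\<in>V. (?z v)\<^sup>2) = 1 + 2 * t * x w + t\<^sup>2" .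
      then show ?thesis using bound[of ?z] 1 by (simp add: c_def algebra_simps)
    qed
    have "c = 0"
    proof (rule ccontr)
      assume "c \<noteq> 0"
      then have c2: "c\<^sup>2 > 0" by simp
      \<comment> \<open>The linear term of \<open>quad\<close> must vanish: for
        \<open>c \<noteq> 0\<close>, the choice \<open>t = c / k\<close> with \<open>k > l\<close>
        violates it.\<close>
      define k where "k = \<bar>l\<bar> + 1"
      have k: "k > 0" "l < k" by (auto simp: k_def)
      have "(c / k) * c \<le> l * (c / k)\<^sup>2" by (rule quad)
      then have "c\<^sup>2 * k \<le> l * c\<^sup>2" using k by (simp add: field_simps power2_eq_square)
      then have "c\<^sup>2 * k \<le> c\<^sup>2 * l" by (simp add: mult.commute)
      then show False using k c2 by (simp add: mult_le_cancel_left_pos)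
    qed
    then show ?thesis by (simp add: c_def)
  qed
  then have "perron V x l" using x bound unfolding perron_def by blast
  then show ?thesis by blast
qed

text \<open>For empty \<open>V\<close> there is no Perron pair and the value is arbitrary; the
  Rayleigh bound \<open>adj_form_le_top\<close> still holds, as both sides are zero.\<close>

definition top_eigenvalue :: "'a set \<Rightarrow> real" where
  "top_eigenvalue V = (SOME l. \<exists>x. perron V x l)"

lemma obtain_perron:
  assumes "finite V" "V \<noteq> {}"
  obtains x where "perron V x (top_eigenvalue V)"
  using someI_ex[OF ex_perron[OF assms]] unfolding top_eigenvalue_def by blast

lemma adj_form_le_top:
  assumes "finite V"
  shows "adj_form V z \<le> top_eigenvalue V * (\<Sum>v\<in>V. (z v)\<^sup>2)"
proof (cases "V = {}")
  case False
  then show ?thesis using obtain_perron[OF assms False] unfolding perron_def by metis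
qed (simp add: adj_form_def)

lemma perron_adj_form:
  assumes "perron V x l"
  shows "adj_form V x = l"
proof -
  have "adj_form V x = (\<Sum>u\<in>V. x u * (\<Sum>v\<in>nbrs V u. x v))" by (simp add: adj_form_def sum_distrib_left)
  also have "\<dots> = (\<Sum>u\<in>V. l * (x u)\<^sup>2)"
    by (intro sum.cong refl) (use assms in \<open>simp add: perron_def power2_eq_square\<close>)
  also have "\<dots> = l" using assms by (simp add: perron_def sum_distrib_left[symmetric])
  finally show ?thesis .
qed

text \<open>Cauchy--Schwarz over ordered edges. It passes from the eigenvector to the probability
  weights \<open>(x v)^2\<close>, and both factors on the right are bounded by
  \<open>adj_form_le\<close>.\<close>

lemma perron_square_le:
  assumes V: "finite V" and p: "perron V x l"
  shows "l\<^sup>2 \<le> real (degree_sum V) * adj_form V (\<lambda>v. (x v)\<^sup>2)"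
proof -
  let ?P = "SIGMA u:V. nbrs V u"
  have "l = (\<Sum>p\<in>?P. 1 * (x (fst p) * x (snd p)))"
    unfolding perron_adj_form[OF p, symmetric] adj_form_def
    using V by (subst sum.Sigma) (auto simp: case_prod_unfold)
  then have "l\<^sup>2 \<le> (\<Sum>p\<in>?P. 1\<^sup>2) * (\<Sum>p\<in>?P. (x (fst p) * x (snd p))\<^sup>2)"
    by (simp only:) (rule Cauchy_Schwarz_ineq_sum)
  also have "(\<Sum>p\<in>?P. 1\<^sup>2) = real (degree_sum V)"
    using V by (simp add: degree_sum_def)
  also have "(\<Sum>p\<in>?P. (x (fst p) * x (snd p))\<^sup>2) = adj_form V (\<lambda>v. (x v)\<^sup>2)"
    unfolding adj_form_def using V by (subst sum.Sigma) (auto simp: case_prod_unfold power_mult_distrib)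
  finally show ?thesis .
qed

lemma perron_entry_le:
  assumes V: "finite V" and p: "perron V x l" and u: "u \<in> V"
  shows "l\<^sup>2 * (x u)\<^sup>2 \<le> real (card (nbrs V u)) * (\<Sum>v\<in>nbrs V u. (x v)\<^sup>2)"
proof -
  have "l\<^sup>2 * (x u)\<^sup>2 = (\<Sum>v\<in>nbrs V u. 1 * x v)\<^sup>2"
    using p u by (simp add: perron_def power_mult_distrib)
  also have "\<dots> \<le> (\<Sum>v\<in>nbrs V u. 1\<^sup>2) * (\<Sum>v\<in>nbrs V u. (x v)\<^sup>2)" by (rule Cauchy_Schwarz_ineq_sum)
  finally show ?thesis by simp
qed

text \<open>The vertex with the smallest entry of the Perron vector is deleted. Its entry is small as soon
  as some vertex has small degree.\<close>

lemma delete_smallest_entry: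
  assumes V: "finite V" and u: "u \<in> V" and d: "real (card (nbrs V u)) \<le> d"
  defines "m \<equiv> real (card V)" and "l \<equiv> top_eigenvalue V"
  shows "\<exists>w\<in>V. \<exists>X. 0 \<le> X \<and> m * X \<le> 1 \<and> X * (l\<^sup>2 + d * (m - d)) \<le> d \<and>
     l * (1 - 2 * X) \<le> top_eigenvalue (V - {w}) * (1 - X)"
proof -
  have V0: "V \<noteq> {}" using u by auto
  obtain x where p: "perron V x l" using obtain_perron[OF V V0] unfolding l_def by blast
  have x0: "x v \<ge> 0" if "v \<in> V" for v using p that by (simp add: perron_def)
  have x1: "(\<Sum>v\<in>V. (x v)\<^sup>2) = 1" using p by (simp add: perron_def)
  obtain w where w: "w \<in> V" "\<And>v. v \<in> V \<Longrightarrow> x w \<le> x v"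
    using arg_min_if_finite[OF V V0, of x] by (metis linorder_not_less)
  define X where "X = (x w)\<^sup>2"
  have X: "X \<ge> 0" "X \<le> (x v)\<^sup>2" if "v \<in> V" for v
    using w that x0 by (auto simp: X_def power_mono)
  have mX: "m * X \<le> 1"
  proof -
    have "m * X = (\<Sum>v\<in>V. X)" by (simp add: m_def)
    also have "\<dots> \<le> 1" unfolding x1[symmetric] by (intro sum_mono X)
    finally show ?thesis .
  qed
  define d' where "d' = real (card (nbrs V u))"
  have nb: "nbrs V u \<subseteq> V" by (auto simp: nbrs_def)
  have "(\<Sum>v\<in>V. (x v)\<^sup>2) = (\<Sum>v\<in>V - nbrs V u. (x v)\<^sup>2) + (\<Sum>v\<in>nbrs V u. (x v)\<^sup>2)"
    by (rule sum.subset_diff[OF nb V])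
  moreover have "(m - d') * X \<le> (\<Sum>v\<in>V - nbrs V u. (x v)\<^sup>2)"
  proof -
    have "(m - d') * X = (\<Sum>v\<in>V - nbrs V u. X)"
      using V nb by (simp add: m_def d'_def card_Diff_subset of_nat_diff card_mono finite_subset)
    also have "\<dots> \<le> (\<Sum>v\<in>V - nbrs V u. (x v)\<^sup>2)" by (intro sum_mono X) auto
    finally show ?thesis .
  qed
  ultimately have nsum: "(\<Sum>v\<in>nbrs V u. (x v)\<^sup>2) \<le> 1 - (m - d') * X" using x1 by linarith
  have "l\<^sup>2 * X \<le> l\<^sup>2 * (x u)\<^sup>2" using X u by (intro mult_left_mono) auto
  also have "\<dots> \<le> d' * (\<Sum>v\<in>nbrs V u. (x v)\<^sup>2)" unfolding d'_def by (rule perron_entry_le[OF V p u])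
  also have "\<dots> \<le> d' * (1 - (m - d') * X)" using nsum by (intro mult_left_mono) (auto simp: d'_def)
  finally have "l\<^sup>2 * X \<le> d' * (1 - (m - d') * X)" .
  \<comment> \<open>Replaces the true degree \<open>d'\<close> by its bound \<open>d\<close>: this
    product is the increase of \<open>d * (1 - (m - d) * X)\<close> from \<open>d'\<close> to
    \<open>d\<close>.\<close>
  moreover have "(d - d') * (1 - m * X + X * (d + d')) \<ge> 0"
    using mX d X(1)[OF u] by (intro mult_nonneg_nonneg add_nonneg_nonneg) (auto simp: d'_def)
  ultimately have main: "X * (l\<^sup>2 + d * (m - d)) \<le> d" by (simp add: algebra_simps)
  have nw: "(\<Sum>v\<in>nbrs V w. x v) = l * x w" using p w(1) unfolding perron_def by blast
  \<comment> \<open>The restriction of \<open>x\<close> serves as test vector on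
    \<open>V - {w}\<close>. It loses \<open>2 * l * X\<close> in the form and \<open>X\<close> in
    the squared norm.\<close>
  have "adj_form V x = adj_form (V - {w}) x + 2 * x w * (\<Sum>v\<in>nbrs V w. x v)"
    by (rule adj_form_remove[OF V w(1)])
  then have "adj_form (V - {w}) x = l * (1 - 2 * X)"
    using perron_adj_form[OF p] nw by (simp add: X_def algebra_simps power2_eq_square)
  moreover have "adj_form (V - {w}) x \<le> top_eigenvalue (V - {w}) * (\<Sum>v\<in>V - {w}. (x v)\<^sup>2)"
    by (rule adj_form_le_top) (use V in auto)
  moreover have "(\<Sum>v\<in>V - {w}. (x v)\<^sup>2) = 1 - X"
    using sum.remove[OF V w(1), of "\<lambda>v. (x v)\<^sup>2"] x1 by (simp add: X_def)
  ultimately have "l * (1 - 2 * X) \<le> top_eigenvalue (V - {w}) * (1 - X)" by simp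
  then show ?thesis using w(1) mX main X(1)[OF u] by blast
qed

section \<open>Upper bounds for the largest eigenvalue\<close>

lemma perron_square_weights:
  assumes "perron V x l" "finite V"
  shows "(\<Sum>v\<in>V. (x v)\<^sup>2) = 1" "\<And>v. v \<in> V \<Longrightarrow> (x v)\<^sup>2 \<le> 1"
proof -
  show 1: "(\<Sum>v\<in>V. (x v)\<^sup>2) = 1" using assms by (simp add: perron_def)
  fix v assume "v \<in> V"
  then show "(x v)\<^sup>2 \<le> 1" unfolding 1[symmetric] using assms(2) by (intro member_le_sum) auto
qed

text \<open>Without \<open>(r + 1)\<close>-cliques \<open>adj_form_le\<close> applies with
  \<open>J = 0\<close> and has no error term. These sharp bounds are what later ties the losses to
  \<open>b\<close>.\<close>

lemma top_square_le_of_free: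
  assumes V: "finite V" "V \<noteq> {}" and r: "r \<ge> 2" and free: "cliques V (Suc r) = {}"
  shows "(top_eigenvalue V)\<^sup>2 \<le> real (degree_sum V) * (1 - 1 / real r)"
    and "real (degree_sum V) \<le> (1 - 1 / real r) * (real (card V))\<^sup>2"
proof -
  have J: "edge_cliques_le V (Suc r) 0" using free by (simp add: edge_cliques_le_def)
  obtain x where p: "perron V x (top_eigenvalue V)" using obtain_perron[OF V] .
  have "adj_form V (\<lambda>v. (x v)\<^sup>2) \<le> 1 - 1 / real r + 1 ^ (r - 1) * 0 * real r ^ (r - 2)"
    by (rule adj_form_le) (use V r J perron_square_weights[OF p V(1)] in auto)
  then have "real (degree_sum V) * adj_form V (\<lambda>v. (x v)\<^sup>2) \<le> real (degree_sum V) * (1 - 1 / real r)"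
    by (intro mult_left_mono) auto
  then show "(top_eigenvalue V)\<^sup>2 \<le> real (degree_sum V) * (1 - 1 / real r)"
    using perron_square_le[OF V(1) p] by linarith
  show "real (degree_sum V) \<le> (1 - 1 / real r) * (real (card V))\<^sup>2"
    using degree_sum_le[OF V _ J r] by simp
qed

text \<open>The entries of the Perron vector satisfy \<open>(x v)\<^sup>2 \<le> 4 / m\<close>, so \<open>adj_form_le\<close> applies to
  the weights \<open>(x v)\<^sup>2\<close>.\<close>

lemma top_eigenvalue_le:
  fixes n :: nat
  assumes V: "finite V" "V \<noteq> {}" and r: "r \<ge> 2" and n: "real n \<le> 2 * real (card V)"
    and J: "edge_cliques_le V (Suc r) (real n ^ (r - 1) / real r ^ (2 * r + 5))"
  shows "top_eigenvalue V \<le> (1 - 1 / real r + 5 / (32 * real r ^ 4)) * real (card V)"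
proof (rule ccontr)
  define a where "a = 1 - 1 / real r"
  define m where "m = real (card V)"
  define l where "l = top_eigenvalue V"
  define J0 where "J0 = real n ^ (r - 1) / real r ^ (2 * r + 5)"
  assume "\<not> ?thesis"
  then have gt: "l > (a + 5 / (32 * real r ^ 4)) * m" by (simp add: a_def m_def l_def)
  have m: "m > 0" using V by (simp add: m_def card_gt_0_iff)
  have r0: "real r \<ge> 2" using r by simp
  have a: "a \<ge> 1 / 2" using r0 by (simp add: a_def field_simps)
  have J0: "J0 \<ge> 0" by (simp add: J0_def)
  \<comment> \<open>The error term of \<open>adj_form_le\<close> for weights up to
    \<open>c / m\<close>, with \<open>n / m \<le> 2\<close>. It is used for \<open>c = 4\<close>
    (squared Perron entries) and \<open>c = 1\<close> (uniform weights).\<close>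
  have excess: "(c / m) ^ (r - 1) * J0 * real r ^ (r - 2) \<le> (2 * c) ^ (r - 1) / real r ^ (r + 7)"
    if c: "c \<ge> 0" for c
  proof -
    have "(c / m) ^ (r - 1) * real n ^ (r - 1) = (c / m * real n) ^ (r - 1)" by (simp only: power_mult_distrib)
    also have "\<dots> \<le> (2 * c) ^ (r - 1)"
    proof (intro power_mono)
      have "c * real n \<le> c * (2 * m)" using n c by (intro mult_left_mono) (auto simp: m_def)
      then show "c / m * real n \<le> 2 * c" using m by (simp add: field_simps)
    qed (use c m in auto)
    finally have 1: "(c / m) ^ (r - 1) * real n ^ (r - 1) \<le> (2 * c) ^ (r - 1)" .
    have "2 * r + 5 = (r - 2) + (r + 7)" using r by simp
    then have 2: "real r ^ (2 * r + 5) = real r ^ (r - 2) * real r ^ (r + 7)" by (simp only: power_add)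
    have "(c / m) ^ (r - 1) * J0 * real r ^ (r - 2) = (c / m) ^ (r - 1) * real n ^ (r - 1) / real r ^ (r + 7)"
      unfolding J0_def 2 using r0 by simp
    also have "\<dots> \<le> (2 * c) ^ (r - 1) / real r ^ (r + 7)" using 1 by (intro divide_right_mono) auto
    finally show ?thesis .
  qed
  have e8: "8 ^ (r - 1) / real r ^ (r + 7) \<le> 1 / (4 * real r ^ 4)"
  proof -
    have "4 * 8 ^ (r - 1) * real r ^ 4 \<le> real r ^ (r + 3) * real r ^ 4"
      using four_mult_eight_power_le[OF r] by (intro mult_right_mono) auto
    also have "\<dots> = real r ^ (r + 7)" by (simp add: power_add[symmetric] add.assoc)
    finally show ?thesis using r0 by (simp add: field_simps)
  qed
  have e2: "2 ^ (r - 1) / real r ^ (r + 7) \<le> 1 / (16 * real r ^ 4)"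
  proof -
    have "(4::real) ^ 1 \<le> 4 ^ (r - 1)" using r by (intro power_increasing) auto
    then have "2 ^ (r - 1) * 4 \<le> 2 ^ (r - 1) * (4 ^ (r - 1) :: real)" by (intro mult_left_mono) auto
    also have "\<dots> = 8 ^ (r - 1)" by (simp add: power_mult_distrib[symmetric])
    finally have "2 ^ (r - 1) * 4 / real r ^ (r + 7) \<le> 8 ^ (r - 1) / real r ^ (r + 7)"
      by (intro divide_right_mono) auto
    then have "4 * (2 ^ (r - 1) / real r ^ (r + 7)) \<le> 1 / (4 * real r ^ 4)" using e8 by simp
    then show ?thesis by simp
  qed
  obtain x where p: "perron V x l" using obtain_perron[OF V] unfolding l_def .
  have am: "a * m \<ge> 0" "a * m \<le> l"
  proof -
    have "5 / (32 * real r ^ 4) * m \<ge> 0" using m by simp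
    then show "a * m \<le> l" using gt by (simp add: distrib_right)
  qed (use a m in auto)
  have entry: "(x v)\<^sup>2 \<le> 4 / m" if v: "v \<in> V" for v
  proof -
    have "(1 / 2 * m)\<^sup>2 \<le> l\<^sup>2"
      using am(2) mult_right_mono[OF a, of m] m by (intro power_mono) linarith+
    then have "(1 / 2 * m)\<^sup>2 * (x v)\<^sup>2 \<le> l\<^sup>2 * (x v)\<^sup>2" by (intro mult_right_mono) auto
    also have "\<dots> \<le> real (card (nbrs V v)) * (\<Sum>v\<in>nbrs V v. (x v)\<^sup>2)" by (rule perron_entry_le[OF V(1) p v])
    also have "\<dots> \<le> m * (\<Sum>v\<in>V. (x v)\<^sup>2)"
      unfolding m_def using V(1) by (intro mult_mono sum_mono2 sum_nonneg) (auto simp: nbrs_def card_mono)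
    finally show ?thesis
      using m perron_square_weights(1)[OF p V(1)] by (simp add: field_simps power2_eq_square)
  qed
  have "adj_form V (\<lambda>v. (x v)\<^sup>2) \<le> 1 - 1 / real r + (4 / m) ^ (r - 1) * J0 * real r ^ (r - 2)"
    by (rule adj_form_le) (use V r J m J0 entry perron_square_weights[OF p V(1)] in \<open>auto simp: J0_def\<close>)
  then have t1: "adj_form V (\<lambda>v. (x v)\<^sup>2) \<le> a + 1 / (4 * real r ^ 4)"
    using excess[of 4] e8 by (simp add: a_def)
  have t0: "real (degree_sum V) \<le> (a + 1 / (16 * real r ^ 4)) * m\<^sup>2"
  proof -
    have "real (degree_sum V) \<le> (a + (1 / m) ^ (r - 1) * J0 * real r ^ (r - 2)) * m\<^sup>2"
      unfolding a_def m_def J0_def by (rule degree_sum_le[OF V _ J r]) auto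
    also have "\<dots> \<le> (a + 1 / (16 * real r ^ 4)) * m\<^sup>2"
      using excess[of 1] e2 by (intro mult_right_mono add_left_mono) auto
    finally show ?thesis .
  qed
  have "l\<^sup>2 \<le> real (degree_sum V) * adj_form V (\<lambda>v. (x v)\<^sup>2)" by (rule perron_square_le[OF V(1) p])
  also have "\<dots> \<le> real (degree_sum V) * (a + 1 / (4 * real r ^ 4))" using t1 by (intro mult_left_mono) auto
  also have "\<dots> \<le> (a + 1 / (16 * real r ^ 4)) * m\<^sup>2 * (a + 1 / (4 * real r ^ 4))"
    using t0 a r0 by (intro mult_right_mono) auto
  finally have "l\<^sup>2 \<le> ((a + 1 / (16 * real r ^ 4)) * m) * ((a + 1 / (4 * real r ^ 4)) * m)"
    by (simp add: power2_eq_square mult_ac)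
  \<comment> \<open>\<open>5 / 32\<close> is the mean of the two errors \<open>1 / 16\<close> and
    \<open>1 / 4\<close>.\<close>
  then have "l \<le> ((a + 1 / (16 * real r ^ 4)) * m + (a + 1 / (4 * real r ^ 4)) * m) / 2"
    using a m by (intro square_root_le_mean) auto
  also have "\<dots> = (a + 5 / (32 * real r ^ 4)) * m" using r0 by (simp add: field_simps)
  finally show False using gt by simp
qed

text \<open>Induction on the allowed number \<open>k\<close> of deletions; the final disjunction
  lets a process that has stopped pass unchanged to \<open>k + 1\<close>. The bound
  \<open>2 * k \<le> n\<close> keeps at least half of the vertices, so that lower-order terms stay
  small, and the gain \<open>7 / 10 * e / m\<close> is at least \<open>7 / (20 r^4) / n\<close>
  because \<open>m \<le> n\<close>.\<close>

lemma deletion_process: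
  fixes n :: nat
  assumes V: "finite V" "card V = n" and r: "r \<ge> 2" and b: "0 \<le> b" "b \<le> 1 / (40 * real r ^ 4)"
    and n: "real n \<ge> 16 * real r ^ 4"
    and top: "top_eigenvalue V \<ge> (1 - 1 / real r - b) * real n"
  shows "2 * k \<le> n \<Longrightarrow> \<exists>W j. W \<subseteq> V \<and> j \<le> k \<and> card W = n - j \<and>
     top_eigenvalue W / real (n - j) \<ge> 1 - 1 / real r - b + real j * (7 / (20 * real r ^ 4)) / real n \<and>
     (j = k \<or> (\<forall>u\<in>W. real (card (nbrs W u)) > (1 - 1 / real r - 1 / (2 * real r ^ 4)) * real (card W)))"
proof (induction k)
  case 0
  have "real r ^ 4 > 0" using r by simp
  then have "real n > 0" using n by linarith
  then show ?case using V top by (intro exI[of _ V] exI[of _ 0]) (simp add: pos_le_divide_eq)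
next
  case (Suc k)
  define a where "a = 1 - 1 / real r"
  define e where "e = 1 / (2 * real r ^ 4)"
  have r0: "real r \<ge> 2" using r by simp
  have r4: "real r ^ 4 \<ge> 16" using power_mono[OF r0, of 4] by simp
  have k: "2 * k \<le> n" using Suc.prems by simp
  obtain W j where W: "W \<subseteq> V" "j \<le> k" "card W = n - j"
    and f: "top_eigenvalue W / real (n - j) \<ge> a - b + real j * (7 / (20 * real r ^ 4)) / real n"
    and alt: "j = k \<or> (\<forall>u\<in>W. real (card (nbrs W u)) > (a - e) * real (card W))"
    using Suc.IH[OF k] unfolding a_def e_def by blast
  show ?case
  proof (cases "\<forall>u\<in>W. real (card (nbrs W u)) > (a - e) * real (card W)")
    case True
    then show ?thesis using W f unfolding a_def e_def by (intro exI[of _ W] exI[of _ j]) auto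
  next
    case False
    then have jk: "j = k" using alt by blast
    obtain u where u: "u \<in> W" "real (card (nbrs W u)) \<le> (a - e) * real (card W)" using False by force
    define m where "m = real (card W)"
    have fW: "finite W" using W V finite_subset by auto
    have mn: "m = real n - real k" using W jk Suc.prems by (simp add: m_def of_nat_diff)
    have m2: "2 * m \<ge> real n" using mn of_nat_mono[OF k, where 'a = real] by simp
    have m1: "m \<ge> 8 * real r ^ 4" using m2 n by linarith
    have mbig: "m > 1" using m1 r4 by linarith
    obtain w X where w: "w \<in> W" and X: "0 \<le> X" "m * X \<le> 1"
      "X * ((top_eigenvalue W)\<^sup>2 + (a - e) * m * (m - (a - e) * m)) \<le> (a - e) * m"
      "top_eigenvalue W * (1 - 2 * X) \<le> top_eigenvalue (W - {w}) * (1 - X)"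
      using delete_smallest_entry[OF fW u] unfolding m_def by blast
    have fm: "top_eigenvalue W / m \<ge> a - b + real k * (7 / (20 * real r ^ 4)) / real n"
      using f W jk by (simp add: m_def)
    have "real k * (7 / (20 * real r ^ 4)) / real n \<ge> 0" by simp
    then have "top_eigenvalue W / m \<ge> a - b" using fm by linarith
    then have l: "top_eigenvalue W \<ge> (a - b) * m" using mbig by (simp add: pos_le_divide_eq)
    have "top_eigenvalue (W - {w}) / (m - 1) \<ge> top_eigenvalue W / m + 7 / 10 * e / m"
    proof (rule deletion_gain_arith[where a = a and b = b and X = X])
      show "0 < e" "e \<le> 1 / 32" using r4 r by (auto simp: e_def field_simps)
      show "b \<le> e / 20" using b by (simp add: e_def)
      show "1 / 2 \<le> a" "a \<le> 1" using r0 by (auto simp: a_def field_simps)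
      show "4 \<le> m * e" using m1 r by (simp add: e_def field_simps)
    qed (use b mbig l X in auto)
    moreover have "7 / 10 * e / m \<ge> 7 / (20 * real r ^ 4) / real n"
    proof -
      have "7 / (20 * real r ^ 4) / real n \<le> 7 / (20 * real r ^ 4) / m"
        using mn mbig r4 by (intro divide_left_mono mult_pos_pos) auto
      then show ?thesis by (simp add: e_def)
    qed
    ultimately have "top_eigenvalue (W - {w}) / (m - 1) \<ge> a - b + real k * (7 / (20 * real r ^ 4)) / real n + 7 / (20 * real r ^ 4) / real n"
      using fm by linarith
    moreover have "real k * (7 / (20 * real r ^ 4)) / real n + 7 / (20 * real r ^ 4) / real n = real (Suc k) * (7 / (20 * real r ^ 4)) / real n"
      by (simp add: distrib_right add_divide_distrib)
    moreover have "real (n - Suc k) = m - 1" using mn Suc.prems by (simp add: of_nat_diff)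
    moreover have "card (W - {w}) = n - Suc k" using w W jk fW by simp
    ultimately show ?thesis using W unfolding a_def
      by (intro exI[of _ "W - {w}"] exI[of _ "Suc k"]) auto
  qed
qed

section \<open>Stability\<close>

text \<open>One clique would yield an edge in at least
  \<open>5 / 6 * n^(r - 1) / r^(2 r + 1)\<close> cliques, using
  \<open>n \<le> 2 * m \<le> r * m\<close>. This exceeds the allowed number by a factor of
  \<open>5 / 6 * r^4\<close>.\<close>

lemma clique_free_of_min_degree:
  fixes n :: nat
  assumes W: "finite W" and r: "r \<ge> 2" and n: "0 < n" "real n \<le> 2 * real (card W)"
    and J: "edge_cliques_le W (Suc r) (real n ^ (r - 1) / real r ^ (2 * r + 5))"
    and deg: "\<And>u. u \<in> W \<Longrightarrow> real (card (nbrs W u)) \<ge> (1 - 1 / real r - 1 / (2 * real r ^ 4)) * real (card W)"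
  shows "cliques W (Suc r) = {}"
proof (rule ccontr)
  define m where "m = real (card W)"
  assume "cliques W (Suc r) \<noteq> {}"
  then obtain u v where uv: "u \<in> W" "v \<in> W" "E u v"
    and big: "real (card {R\<in>cliques W (Suc r). u \<in> R \<and> v \<in> R}) \<ge> (m / real r) ^ (r - 1) * (5 / (6 * real r ^ 3))"
    using ex_edge_many_cliques[OF W r _ deg] unfolding m_def by blast
  have r0: "real r \<ge> 2" using r by simp
  have r4: "real r ^ 4 \<ge> 16" using power_mono[OF r0, of 4] by simp
  have n0: "real n ^ (r - 1) > 0" using n by simp
  have "real n / real r ^ 2 \<le> m / real r"
  proof -
    have "real n / real r ^ 2 \<le> (2 * m) / real r ^ 2" using n(2) by (intro divide_right_mono) (auto simp: m_def)
    also have "\<dots> = 2 / real r * (m / real r)" by (simp add: power2_eq_square)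
    also have "\<dots> \<le> 1 * (m / real r)" using r0 by (intro mult_right_mono) (auto simp: m_def)
    finally show ?thesis by simp
  qed
  then have "(real n / real r ^ 2) ^ (r - 1) \<le> (m / real r) ^ (r - 1)" by (intro power_mono) auto
  then have "(real n / real r ^ 2) ^ (r - 1) * (5 / (6 * real r ^ 3)) \<le> (m / real r) ^ (r - 1) * (5 / (6 * real r ^ 3))"
    by (intro mult_right_mono) auto
  also have "\<dots> \<le> real n ^ (r - 1) / real r ^ (2 * r + 5)"
    using big J uv unfolding edge_cliques_le_def by fastforce
  finally have le: "(real n / real r ^ 2) ^ (r - 1) * (5 / (6 * real r ^ 3)) \<le> real n ^ (r - 1) / real r ^ (2 * r + 5)" .
  define P where "P = real r ^ (2 * (r - 1))"
  define A where "A = real n ^ (r - 1) / (P * real r ^ 3)"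
  have A: "A > 0" using n0 r0 by (simp add: A_def P_def)
  have "(real n / real r ^ 2) ^ (r - 1) = real n ^ (r - 1) / P"
    by (simp add: P_def power_divide power_mult)
  then have lhs: "(real n / real r ^ 2) ^ (r - 1) * (5 / (6 * real r ^ 3)) = A * (5 / 6)" by (simp add: A_def)
  have "2 * r + 5 = 2 * (r - 1) + (3 + 4)" using r by simp
  then have "real r ^ (2 * r + 5) = P * (real r ^ 3 * real r ^ 4)" unfolding P_def by (simp only: power_add)
  then have rhs: "real n ^ (r - 1) / real r ^ (2 * r + 5) = A * (1 / real r ^ 4)"
    by (simp only: A_def times_divide_times_eq mult.assoc mult_1_right)
  have "A * (5 / 6) \<le> A * (1 / real r ^ 4)" using le unfolding lhs rhs .
  then have "5 / 6 \<le> 1 / real r ^ 4" using A by (simp only: mult_le_cancel_left_pos)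
  then show False using r4 r by (simp add: field_simps)
qed

text \<open>The variance identity for the class sizes. Keeping the deviation term lets the deficit
  of edges control both the imbalance of the parts and the missing cross pairs.\<close>

lemma sum_over_classes:
  fixes c :: "'a \<Rightarrow> nat" and r :: nat
  assumes W: "finite W" and c: "\<forall>u\<in>W. c u < r" and r: "r > 0"
  defines "p i \<equiv> real (card {u\<in>W. c u = i})"
  shows "(\<Sum>u\<in>W. p (c u)) = (real (card W))\<^sup>2 / real r + (\<Sum>i<r. (p i - real (card W) / real r)\<^sup>2)"
proof -
  let ?m = "real (card W)"
  have img: "c ` W \<subseteq> {..<r}" using c by auto
  have 1: "(\<Sum>u\<in>W. p (c u)) = (\<Sum>i<r. (p i)\<^sup>2)"
  proof -
    have "(\<Sum>u\<in>W. p (c u)) = (\<Sum>i<r. \<Sum>u\<in>{u\<in>W. c u = i}. p (c u))"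
      using sum.group[OF W _ img, of "\<lambda>u. p (c u)"] by simp
    also have "\<dots> = (\<Sum>i<r. (p i)\<^sup>2)"
      by (intro sum.cong refl) (simp add: p_def power2_eq_square)
    finally show ?thesis .
  qed
  have 2: "(\<Sum>i<r. p i) = ?m"
    using sum.group[OF W _ img, of "\<lambda>_. 1 :: real"] by (simp add: p_def)
  have "(\<Sum>i<r. (p i - ?m / real r)\<^sup>2) = (\<Sum>i<r. (p i)\<^sup>2 - 2 * (?m / real r) * p i + (?m / real r)\<^sup>2)"
    by (intro sum.cong refl) (simp add: power2_diff)
  also have "\<dots> = (\<Sum>i<r. (p i)\<^sup>2) - 2 * (?m / real r) * (\<Sum>i<r. p i) + real r * (?m / real r)\<^sup>2"
    by (simp add: sum.distrib sum_subtractf sum_distrib_left)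
  also have "\<dots> = (\<Sum>i<r. (p i)\<^sup>2) - ?m\<^sup>2 / real r"
    unfolding 2 using r by (simp add: power2_eq_square field_simps)
  finally show ?thesis using 1 by simp
qed

text \<open>Few cross pairs are missing, so few vertices have small degree, and removing those hardly
  changes the degrees of the others.\<close>

lemma remove_low_degree:
  fixes c :: "'a \<Rightarrow> nat" and n :: nat
  assumes W: "finite W" and r: "r \<ge> 2" and n: "real (card W) \<le> real n" "real n - real (card W) \<le> \<beta> * real n / 2" "n > 0"
    and c: "\<forall>u\<in>W. c u < r" "\<forall>u\<in>W. \<forall>v\<in>W. E u v \<longrightarrow> c u \<noteq> c v"
    and \<beta>: "0 < \<beta>" "\<beta> \<le> 1 / 40"
    and edges: "real (degree_sum W) \<ge> (1 - 1 / real r - 2 * \<beta> ^ 3) * (real (card W))\<^sup>2"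
  shows "\<exists>U\<subseteq>W. real (card U) \<ge> real (card W) - \<beta> * real n \<and>
    (\<forall>u\<in>U. real (card (nbrs U u)) > (1 - 1 / real r - 7 * \<beta>) * real n)"
proof -
  define m where "m = real (card W)"
  define a where "a = 1 - 1 / real r"
  define p where "p i = real (card {u\<in>W. c u = i})" for i
  define missing where "missing u = real (card {v\<in>W. c v \<noteq> c u \<and> \<not> E u v})" for u
  have r0: "real r \<ge> 2" using r by simp
  have a: "0 \<le> a" "a \<le> 1" using r0 by (auto simp: a_def field_simps)
  have split: "m = p (c u) + real (card (nbrs W u)) + missing u" if u: "u \<in> W" for u
  proof -
    have "W = ({v\<in>W. c v = c u} \<union> nbrs W u) \<union> {v\<in>W. c v \<noteq> c u \<and> \<not> E u v}"
      by (auto simp: nbrs_def)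
    moreover have "{v\<in>W. c v = c u} \<inter> nbrs W u = {}" using c(2) u by (force simp: nbrs_def)
    moreover have "({v\<in>W. c v = c u} \<union> nbrs W u) \<inter> {v\<in>W. c v \<noteq> c u \<and> \<not> E u v} = {}"
      by (auto simp: nbrs_def)
    ultimately have "card W = card {v\<in>W. c v = c u} + card (nbrs W u) + card {v\<in>W. c v \<noteq> c u \<and> \<not> E u v}"
      using W by (metis (no_types, lifting) card_Un_disjoint finite_Un)
    then show ?thesis by (simp add: m_def p_def missing_def)
  qed
  have "m\<^sup>2 = (\<Sum>u\<in>W. p (c u) + real (card (nbrs W u)) + missing u)"
  proof -
    have "m\<^sup>2 = (\<Sum>u\<in>W. m)" by (simp add: m_def power2_eq_square)
    also have "\<dots> = (\<Sum>u\<in>W. p (c u) + real (card (nbrs W u)) + missing u)" by (intro sum.cong refl split)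
    finally show ?thesis .
  qed
  also have "\<dots> = (\<Sum>u\<in>W. p (c u)) + real (degree_sum W) + (\<Sum>u\<in>W. missing u)"
    by (simp add: sum.distrib degree_sum_def)
  also have "(\<Sum>u\<in>W. p (c u)) = m\<^sup>2 / real r + (\<Sum>i<r. (p i - m / real r)\<^sup>2)"
    using sum_over_classes[OF W c(1)] r by (simp add: p_def m_def)
  finally have "(\<Sum>i<r. (p i - m / real r)\<^sup>2) + (\<Sum>u\<in>W. missing u) = m\<^sup>2 - m\<^sup>2 / real r - real (degree_sum W)"
    by simp
  also have "\<dots> \<le> 2 * \<beta> ^ 3 * m\<^sup>2" using edges by (simp add: m_def algebra_simps)
  finally have total: "(\<Sum>i<r. (p i - m / real r)\<^sup>2) + (\<Sum>u\<in>W. missing u) \<le> 2 * \<beta> ^ 3 * m\<^sup>2" .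
  have nn1: "(\<Sum>i<r. (p i - m / real r)\<^sup>2) \<ge> 0" by (intro sum_nonneg) auto
  have nn2: "(\<Sum>u\<in>W. missing u) \<ge> 0" by (intro sum_nonneg) (auto simp: missing_def)
  \<comment> \<open>\<open>2 * \<beta> ^ 3\<close> is at most \<open>(\<beta> / 2) ^ 2\<close> as
    soon as \<open>8 * \<beta> \<le> 1\<close>.\<close>
  have p_le: "p i \<le> m / real r + \<beta> * m / 2" if "i < r" for i
  proof -
    have "(p i - m / real r)\<^sup>2 \<le> (\<Sum>i<r. (p i - m / real r)\<^sup>2)" using that by (intro member_le_sum) auto
    also have "\<dots> \<le> 2 * \<beta> ^ 3 * m\<^sup>2" using total nn2 by linarith
    also have "\<dots> = (2 * \<beta>) * (\<beta>\<^sup>2 * m\<^sup>2)" by (simp add: power2_eq_square power3_eq_cube)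
    also have "\<dots> \<le> (1 / 4) * (\<beta>\<^sup>2 * m\<^sup>2)" using \<beta> by (intro mult_right_mono) auto
    also have "\<dots> = (\<beta> * m / 2)\<^sup>2" by (simp add: power2_eq_square)
    finally have "p i - m / real r \<le> \<beta> * m / 2"
      by (rule power2_le_imp_le) (use \<beta> in \<open>simp add: m_def\<close>)
    then show ?thesis by linarith
  qed
  \<comment> \<open>Of the \<open>6 * \<beta> * n\<close>, one half of \<open>\<beta> * n\<close>
    may be lost to an oversized part and another half to vertices outside \<open>W\<close>, so a
    vertex of \<open>L\<close> still misses \<open>5 * \<beta> * n\<close> cross pairs. The seventh
    \<open>\<beta> * n\<close> in the conclusion covers the neighbours lost with
    \<open>L\<close>.\<close>
  define L where "L = {u\<in>W. real (card (nbrs W u)) \<le> (a - 6 * \<beta>) * real n}"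
  have fL: "finite L" "L \<subseteq> W" using W by (auto simp: L_def)
  have \<beta>n: "\<beta> * real n > 0" using \<beta> n by simp
  have miss: "missing u \<ge> 5 * \<beta> * real n" if u: "u \<in> L" for u
  proof -
    have uW: "u \<in> W" using u fL by auto
    have "missing u = m - p (c u) - real (card (nbrs W u))" using split[OF uW] by linarith
    then have "missing u \<ge> m - (m / real r + \<beta> * m / 2) - (a - 6 * \<beta>) * real n"
      using p_le[of "c u"] c(1) uW u by (force simp: L_def)
    moreover have "m - (m / real r + \<beta> * m / 2) - (a - 6 * \<beta>) * real n = 6 * \<beta> * real n - \<beta> * m / 2 - a * (real n - m)"
      by (simp add: a_def algebra_simps diff_divide_distrib)
    moreover have "a * (real n - m) \<le> 1 * (real n - m)" using a n(1) by (intro mult_right_mono) (auto simp: m_def)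
    moreover have "\<beta> * m / 2 \<le> \<beta> * real n / 2" using n(1) \<beta> by (simp add: m_def)
    ultimately show ?thesis using n(2) by (simp add: m_def)
  qed
  have "real (card L) * (5 * \<beta> * real n) = (\<Sum>u\<in>L. 5 * \<beta> * real n)" by simp
  also have "\<dots> \<le> (\<Sum>u\<in>L. missing u)" by (intro sum_mono miss)
  also have "\<dots> \<le> (\<Sum>u\<in>W. missing u)" using W fL by (intro sum_mono2) (auto simp: missing_def)
  also have "\<dots> \<le> 2 * \<beta> ^ 3 * m\<^sup>2" using total nn1 by linarith
  also have "\<dots> \<le> 2 * \<beta> ^ 3 * (real n)\<^sup>2" using n(1) \<beta> by (intro mult_left_mono power_mono) (auto simp: m_def)
  also have "\<dots> = (2 * \<beta>) * (\<beta> * real n) * (\<beta> * real n)" by (simp add: power2_eq_square power3_eq_cube)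
  also have "\<dots> \<le> (1 / 20) * (\<beta> * real n) * (\<beta> * real n)" using \<beta> by (intro mult_right_mono) auto
  finally have "(5 * real (card L)) * (\<beta> * real n) \<le> ((1 / 20) * (\<beta> * real n)) * (\<beta> * real n)" by (simp add: mult_ac)
  then have "5 * real (card L) \<le> (1 / 20) * (\<beta> * real n)" using \<beta>n by (simp only: mult_le_cancel_right_pos)
  then have L: "real (card L) \<le> \<beta> * real n / 100" by simp
  show ?thesis
  proof (intro exI[of _ "W - L"] conjI ballI)
    show "W - L \<subseteq> W" by auto
    have "real (card (W - L)) = real (card W) - real (card L)"
      using fL W by (simp add: card_Diff_subset of_nat_diff card_mono)
    then show "real (card (W - L)) \<ge> real (card W) - \<beta> * real n" using L \<beta>n by linarith
    fix u assume u: "u \<in> W - L"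
    have "nbrs W u \<subseteq> nbrs (W - L) u \<union> L" by (auto simp: nbrs_def)
    then have "card (nbrs W u) \<le> card (nbrs (W - L) u \<union> L)" using W fL by (intro card_mono) auto
    also have "\<dots> \<le> card (nbrs (W - L) u) + card L" by (rule card_Un_le)
    finally have "real (card (nbrs W u)) \<le> real (card (nbrs (W - L) u)) + real (card L)" by linarith
    moreover have "real (card (nbrs W u)) > (a - 6 * \<beta>) * real n" using u by (auto simp: L_def)
    ultimately have "real (card (nbrs (W - L) u)) > (a - 6 * \<beta>) * real n - \<beta> * real n / 100" using L by linarith
    moreover have "(a - 6 * \<beta>) * real n - \<beta> * real n / 100 \<ge> (a - 7 * \<beta>) * real n"
      using \<beta>n by (simp add: algebra_simps)
    ultimately show "real (card (nbrs (W - L) u)) > (1 - 1 / real r - 7 * \<beta>) * real n"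
      unfolding a_def by linarith
  qed
qed

theorem spectral_stability:
  fixes n :: nat
  assumes V: "finite V" "card V = n" and r: "r \<ge> 2" and b: "0 < b" "b < 1 / (2 ^ 10 * real r ^ 6)"
    and n: "n \<ge> r ^ 20" and top: "top_eigenvalue V \<ge> (1 - 1 / real r - b) * real n"
    and J: "edge_cliques_le V (Suc r) (real n ^ (r - 1) / real r ^ (2 * r + 5))"
  shows "\<exists>U\<subseteq>V. real (card U) \<ge> (1 - 4 * b powr (1 / 3)) * real n \<and>
    (\<forall>u\<in>U. real (card (nbrs U u)) > (1 - 1 / real r - 7 * b powr (1 / 3)) * real n) \<and>
    (\<exists>c :: 'a \<Rightarrow> nat. (\<forall>u\<in>U. c u < r) \<and> (\<forall>u\<in>U. \<forall>v\<in>U. E u v \<longrightarrow> c u \<noteq> c v)) \<and> U \<noteq> {}"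
proof -
  define a where "a = 1 - 1 / real r"
  define \<beta> where "\<beta> = b powr (1 / 3)"
  define \<kappa> where "\<kappa> = 7 / (20 * real r ^ 4)"
  have r0: "real r \<ge> 2" using r by simp
  have r4: "real r ^ 4 \<ge> 16" using power_mono[OF r0, of 4] by simp
  have r2: "real r ^ 2 \<ge> 4" using power_mono[OF r0, of 2] by simp
  have a: "1 / 2 \<le> a" "a \<le> 1" using r0 by (auto simp: a_def field_simps)
  have \<beta>0: "\<beta> > 0" using b by (simp add: \<beta>_def)
  have \<beta>3: "\<beta> ^ 3 = b" using b by (simp add: \<beta>_def powr_realpow[symmetric] powr_powr)
  \<comment> \<open>This is how the hypothesis \<open>b < 2^-10 r^-6\<close> enters:
    \<open>2^-10\<close> is just below the cube of \<open>1 / 10\<close>.\<close>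
  have \<beta>r: "\<beta> * real r ^ 2 < 1 / 10"
  proof (rule power_less_imp_less_base)
    have "(\<beta> * real r ^ 2) ^ 3 = b * real r ^ 6" by (simp add: power_mult_distrib \<beta>3 flip: power_mult)
    also have "\<dots> < 1 / 2 ^ 10" using b r0 by (simp add: field_simps)
    also have "\<dots> \<le> (1 / 10) ^ 3" by (simp add: eval_nat_numeral)
    finally show "(\<beta> * real r ^ 2) ^ 3 < (1 / 10) ^ 3" .
  qed simp
  have \<beta>40: "\<beta> \<le> 1 / 40"
    using \<beta>r mult_left_mono[OF r2, of \<beta>] \<beta>0 by linarith
  have br4: "b * real r ^ 4 \<le> \<beta> / 100"
  proof -
    have "b * real r ^ 4 = \<beta> * (\<beta> * real r ^ 2)\<^sup>2"
      by (simp add: \<beta>3[symmetric] power_mult_distrib power2_eq_square power3_eq_cube power4_eq_xxxx)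
    also have "\<dots> \<le> \<beta> * (1 / 10)\<^sup>2" using \<beta>r \<beta>0 by (intro mult_left_mono power_mono) auto
    finally show ?thesis by (simp add: power2_eq_square)
  qed
  have b4: "b \<le> 1 / (4096 * real r ^ 4)"
  proof -
    have "1024 * real r ^ 6 \<ge> 4096 * real r ^ 4"
      using mult_left_mono[OF r2, of "1024 * real r ^ 4"] by (simp flip: power_add)
    then have "1 / (2 ^ 10 * real r ^ 6) \<le> 1 / (4096 * real r ^ 4)"
      using r by (intro divide_left_mono mult_pos_pos zero_less_power) auto
    then show ?thesis using b by linarith
  qed
  have nbig: "real n \<ge> 2 ^ 16 * real r ^ 4"
  proof -
    have "real n \<ge> real (r ^ 20)" using n by (rule of_nat_mono)
    moreover have "real (r ^ 20) = real r ^ 16 * real r ^ 4" by (simp flip: power_add)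
    moreover have "(2::real) ^ 16 \<le> real r ^ 16" using r0 by (intro power_mono) auto
    then have "2 ^ 16 * real r ^ 4 \<le> real r ^ 16 * real r ^ 4" by (intro mult_right_mono) auto
    ultimately show ?thesis by linarith
  qed
  have n0: "real n > 100" using nbig r4 by simp
  have b40: "b \<le> 1 / (40 * real r ^ 4)" using b4 r by (auto elim!: order_trans intro!: divide_left_mono)
  have n16: "real n \<ge> 16 * real r ^ 4" using nbig r4 by simp
  have half: "2 * (n div 2) \<le> n" by simp
  obtain W j where W: "W \<subseteq> V" and j: "j \<le> n div 2" "card W = n - j"
    and f: "top_eigenvalue W / real (n - j) \<ge> a - b + real j * \<kappa> / real n"
    and alt: "j = n div 2 \<or> (\<forall>u\<in>W. real (card (nbrs W u)) > (a - 1 / (2 * real r ^ 4)) * real (card W))"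
    using deletion_process[OF V r less_imp_le[OF b(1)] b40 n16 top half] unfolding a_def \<kappa>_def by blast
  define m where "m = real (card W)"
  have fW: "finite W" using W V finite_subset by auto
  have mn: "m = real n - real j" using j by (simp add: m_def of_nat_diff)
  have m2: "real n \<le> 2 * m" using j mn by linarith
  have W0: "W \<noteq> {}" using m2 n0 by (auto simp: m_def)
  have fm: "top_eigenvalue W / m \<ge> a - b + real j * \<kappa> / real n" using f j(2) by (simp add: m_def)
  have m0: "m > 0" using m2 n0 by linarith
  have JW: "edge_cliques_le W (Suc r) (real n ^ (r - 1) / real r ^ (2 * r + 5))"
    by (rule edge_cliques_le_mono[OF V(1) W J])
  have \<kappa>0: "\<kappa> > 0" using r by (simp add: \<kappa>_def)
  \<comment> \<open>Had all \<open>n div 2\<close> deletions been carried out, the gain would be at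
    least \<open>49 / 100 * \<kappa>\<close>, about \<open>0.171 / r^4\<close>. The crude bound
    permits only \<open>b + 5 / (32 r^4)\<close>, below \<open>0.157 / r^4\<close>. The
    \<open>49 / 100\<close> allows for odd \<open>n\<close>.\<close>
  have deg: "real (card (nbrs W u)) > (a - 1 / (2 * real r ^ 4)) * m" if u: "u \<in> W" for u
  proof (rule ccontr)
    assume "\<not> ?thesis"
    then have jj: "j = n div 2" using alt u by (auto simp: m_def)
    have "top_eigenvalue W \<le> (a + 5 / (32 * real r ^ 4)) * m"
      unfolding a_def m_def by (rule top_eigenvalue_le[OF fW W0 r _ JW]) (use m2 m_def in simp)
    then have "top_eigenvalue W / m \<le> a + 5 / (32 * real r ^ 4)" using m0 by (simp add: pos_divide_le_eq)
    then have "real j * \<kappa> / real n \<le> b + 5 / (32 * real r ^ 4)" using fm by linarith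
    moreover have "real j / real n \<ge> 49 / 100"
    proof -
      have "n \<le> 2 * j + 1" using jj by presburger
      then have "real n \<le> real (2 * j + 1)" by (rule of_nat_mono)
      then have "real j \<ge> (real n - 1) / 2" by simp
      then show ?thesis using n0 by (simp add: field_simps)
    qed
    then have "real j / real n * \<kappa> \<ge> 49 / 100 * \<kappa>" using \<kappa>0 by (intro mult_right_mono) auto
    ultimately have "49 / 100 * \<kappa> \<le> 1 / (4096 * real r ^ 4) + 5 / (32 * real r ^ 4)" using b4 by simp
    then show False using r by (simp add: \<kappa>_def field_simps)
  qed
  have free: "cliques W (Suc r) = {}"
    by (rule clique_free_of_min_degree[OF fW r _ _ JW])
       (use n0 m2 deg in \<open>auto simp: m_def a_def less_imp_le\<close>)
  have nonneg: "a - b > 0"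
  proof -
    have "1 / (4096 * real r ^ 4) \<le> 1 / 4096" using r4 r by (simp add: field_simps)
    then show ?thesis using a b4 by linarith
  qed
  note free_bounds = top_square_le_of_free[OF fW W0 r free, folded a_def m_def]
  have top_ge: "top_eigenvalue W \<ge> (a - b) * m"
  proof -
    have "real j * \<kappa> / real n \<ge> 0" using \<kappa>0 by simp
    then have "top_eigenvalue W / m \<ge> a - b" using fm by linarith
    then show ?thesis using m0 by (simp add: pos_le_divide_eq)
  qed
  have top_le: "top_eigenvalue W \<le> a * m"
  proof (rule power2_le_imp_le)
    have "(top_eigenvalue W)\<^sup>2 \<le> real (degree_sum W) * a" by (rule free_bounds)
    also have "\<dots> \<le> a * m\<^sup>2 * a" using free_bounds(2) a by (intro mult_right_mono) auto
    finally show "(top_eigenvalue W)\<^sup>2 \<le> (a * m)\<^sup>2" by (simp add: power2_eq_square mult_ac)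
  qed (use a m0 in auto)
  have \<beta>n: "\<beta> * real n > 0" using \<beta>0 n0 by simp
  \<comment> \<open>The eigenvalue is now at most \<open>a * m\<close>, so the accumulated gain
    \<open>j * \<kappa> / n\<close> is at most \<open>b\<close>, and
    \<open>20 / 7 * b * r^4 \<le> \<beta> / 35\<close>.\<close>
  have j_le: "real j \<le> 3 / 100 * (\<beta> * real n)"
  proof -
    have "top_eigenvalue W / m \<le> a" using top_le m0 by (simp add: pos_divide_le_eq)
    then have "real j * \<kappa> / real n \<le> b" using fm by linarith
    then have "real j * \<kappa> \<le> b * real n" using n0 by (simp add: pos_divide_le_eq)
    then have "real j * 7 \<le> 20 * ((b * real r ^ 4) * real n)"
      using r by (simp add: \<kappa>_def field_simps)
    also have "(b * real r ^ 4) * real n \<le> \<beta> / 100 * real n" using br4 by (intro mult_right_mono) auto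
    finally have "real j * 7 \<le> (\<beta> * real n) / 5" by simp
    then show ?thesis using \<beta>n by linarith
  qed
  \<comment> \<open>Dropping \<open>b^2\<close> in \<open>(a - b)^2 = (a - 2 * b) * a + b^2\<close>
    lets one factor \<open>a\<close> cancel against the sharp bound.\<close>
  have edges: "real (degree_sum W) \<ge> (a - 2 * \<beta> ^ 3) * m\<^sup>2"
  proof -
    have "((a - b) * m)\<^sup>2 \<le> (top_eigenvalue W)\<^sup>2" using top_ge nonneg m0 by (intro power_mono) auto
    also have "\<dots> \<le> real (degree_sum W) * a" by (rule free_bounds)
    finally have "((a - b) * m)\<^sup>2 \<le> real (degree_sum W) * a" .
    moreover have "((a - b) * m)\<^sup>2 = ((a - 2 * b) * m\<^sup>2) * a + b\<^sup>2 * m\<^sup>2"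
      by (simp add: algebra_simps power2_eq_square)
    moreover have "b\<^sup>2 * m\<^sup>2 \<ge> 0" by simp
    ultimately have "((a - 2 * b) * m\<^sup>2) * a \<le> real (degree_sum W) * a" by linarith
    then show ?thesis using a by (simp add: \<beta>3 mult_le_cancel_right)
  qed
  obtain c :: "'a \<Rightarrow> nat" where c: "\<forall>u\<in>W. c u < r" "\<forall>u\<in>W. \<forall>v\<in>W. E u v \<longrightarrow> c u \<noteq> c v"
    using colourable_of_min_degree[OF fW W0 r free] less_imp_le[OF deg] unfolding a_def m_def by blast
  obtain U where U: "U \<subseteq> W" "real (card U) \<ge> m - \<beta> * real n"
    "\<forall>u\<in>U. real (card (nbrs U u)) > (a - 7 * \<beta>) * real n"
  proof -
    have 1: "real (card W) \<le> real n" "real n - real (card W) \<le> \<beta> * real n / 2" "n > 0"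
      using mn j_le \<beta>n n0 by (auto simp: m_def)
    show ?thesis
      using remove_low_degree[OF fW r 1 c \<beta>0 \<beta>40] edges that unfolding a_def m_def by blast
  qed
  have card: "real (card U) \<ge> (1 - 4 * \<beta>) * real n"
  proof -
    have "real (card U) \<ge> real n - 2 * (\<beta> * real n)" using U(2) mn j_le \<beta>n by linarith
    moreover have "(1 - 4 * \<beta>) * real n = real n - 4 * (\<beta> * real n)" by (simp add: algebra_simps)
    ultimately show ?thesis using \<beta>n by linarith
  qed
  \<comment> \<open>Needed because \<open>min_degree\<close> is a \<open>Min\<close>, which has
    meaning only for a nonempty set.\<close>
  have ne: "U \<noteq> {}"
  proof -
    have "(1 - 4 * \<beta>) * real n > 0" using \<beta>40 n0 by (intro mult_pos_pos) auto
    then show ?thesis using card by auto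
  qed
  show ?thesis
  proof (intro exI[of _ U] conjI)
    show "U \<subseteq> V" using U(1) W by (rule subset_trans)
    show "\<exists>c :: 'a \<Rightarrow> nat. (\<forall>u\<in>U. c u < r) \<and> (\<forall>u\<in>U. \<forall>v\<in>U. E u v \<longrightarrow> c u \<noteq> c v)"
      by (rule exI[of _ c]) (use c U(1) in blast)
  qed (use card ne U(3) in \<open>simp_all add: a_def \<beta>_def\<close>)
qed

end

section \<open>Graphs as symmetric digraphs\<close>

context graph begin

sublocale adj: simple_adjacency "\<lambda>u v. (u, v) \<in> arcs_ends G"
proof
  show "(u, v) \<in> arcs_ends G \<Longrightarrow> (v, u) \<in> arcs_ends G" for u v
    using sym_arcs by (auto simp: symmetric_def dest: symD)
  show "(u, u) \<notin> arcs_ends G" for u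
    using no_loops by (auto simp: arcs_ends_def arc_to_ends_def)
qed

text \<open>The Perron vector shows that the spectrum is nonempty, so its \<open>Max\<close> is
  meaningful. Any eigenvector, read as a function on the vertices through the enumeration, is a test
  vector in the Rayleigh bound.\<close>

lemma graph_index_le_top_eigenvalue:
  assumes "verts G \<noteq> {}"
  shows "graph_index G \<le> adj.top_eigenvalue (verts G)"
proof -
  define V where "V = verts G"
  define l where "l = adj.top_eigenvalue V"
  define vs where "vs = (SOME vs. distinct vs \<and> set vs = verts G)"
  define n where "n = length vs"
  define A where "A = adjacency_matrix G"
  have fV: "finite V" and V0: "V \<noteq> {}" using assms by (auto simp: V_def)
  have "\<exists>vs. distinct vs \<and> set vs = verts G" using finite_distinct_list[of "verts G"] by auto
  then have vs: "distinct vs" "set vs = V" unfolding vs_def V_def by (metis (mono_tags, lifting) someI_ex)+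
  have A: "A = mat n n (\<lambda>(i, j). if (vs ! i, vs ! j) \<in> arcs_ends G then 1 else 0)"
    by (simp add: A_def adjacency_matrix_def vs_def n_def Let_def)
  have Ac: "A \<in> carrier_mat n n" by (simp add: A)
  have bij: "bij_betw ((!) vs) {..<n} V" using vs by (intro bij_betw_nth) (auto simp: n_def)
  have reidx: "(\<Sum>u\<in>V. g u) = (\<Sum>i<n. g (vs ! i))" for g :: "'a \<Rightarrow> real"
    using sum.reindex_bij_betw[OF bij, of g] by simp
  have mult: "(A *\<^sub>v v) $ i = (\<Sum>u\<in>adj.nbrs V (vs ! i). x u)"
    if i: "i < n" and v: "v = vec n (\<lambda>i. x (vs ! i))" for v x i
  proof -
    have "(A *\<^sub>v v) $ i = (\<Sum>j<n. (if (vs ! i, vs ! j) \<in> arcs_ends G then 1 else 0) * x (vs ! j))"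
      using i v by (simp add: A scalar_prod_def atLeast0LessThan)
    also have "\<dots> = (\<Sum>u\<in>V. (if (vs ! i, u) \<in> arcs_ends G then 1 else 0) * x u)"
      by (simp only: reidx)
    also have "\<dots> = (\<Sum>u\<in>V. if (vs ! i, u) \<in> arcs_ends G then x u else 0)"
      by (intro sum.cong) auto
    also have "\<dots> = (\<Sum>u\<in>adj.nbrs V (vs ! i). x u)"
      unfolding adj.nbrs_def by (rule sum.inter_filter[OF fV, symmetric])
    finally show ?thesis .
  qed
  obtain x where p: "adj.perron V x l" using adj.obtain_perron[OF fV V0] unfolding l_def .
  have "l \<in> spectrum A"
  proof -
    define v where "v = vec n (\<lambda>i. x (vs ! i))"
    have "A *\<^sub>v v = l \<cdot>\<^sub>v v"
    proof (rule eq_vecI)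
      fix i assume "i < dim_vec (l \<cdot>\<^sub>v v)"
      then have i: "i < n" by (simp add: v_def)
      have "vs ! i \<in> V" using i vs by (auto simp: n_def)
      then show "(A *\<^sub>v v) $ i = (l \<cdot>\<^sub>v v) $ i"
        using mult[OF i v_def] p i by (simp add: adj.perron_def v_def)
    qed (simp add: A v_def)
    moreover have "v \<noteq> 0\<^sub>v n"
    proof
      assume "v = 0\<^sub>v n"
      then have "x (vs ! i) = 0" if "i < n" for i using that by (metis index_vec index_zero_vec(1) v_def)
      then have "(\<Sum>u\<in>V. (x u)\<^sup>2) = 0" by (simp add: reidx)
      then show False using p by (simp add: adj.perron_def)
    qed
    ultimately show ?thesis
      unfolding spectrum_def eigenvalue_def eigenvector_def using Ac
      by (auto intro!: exI[of _ v]) (simp add: v_def)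
  qed
  moreover have "k \<le> l" if "k \<in> spectrum A" for k
  proof -
    from that obtain v where v: "v \<in> carrier_vec n" "v \<noteq> 0\<^sub>v n" "A *\<^sub>v v = k \<cdot>\<^sub>v v"
      using Ac unfolding spectrum_def eigenvalue_def eigenvector_def by auto
    define x where "x u = v $ (inv_into {..<n} ((!) vs) u)" for u
    have xi: "x (vs ! i) = v $ i" if "i < n" for i
      using bij that by (simp add: x_def bij_betw_def inv_into_f_f)
    have vx: "v = vec n (\<lambda>i. x (vs ! i))" using v(1) xi by (intro eq_vecI) auto
    have "adj.adj_form V x = (\<Sum>u\<in>V. x u * (\<Sum>w\<in>adj.nbrs V u. x w))"
      by (simp add: adj.adj_form_def sum_distrib_left)
    also have "\<dots> = (\<Sum>i<n. x (vs ! i) * (A *\<^sub>v v) $ i)"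
      unfolding reidx by (intro sum.cong refl) (simp add: mult[OF _ vx])
    also have "\<dots> = (\<Sum>i<n. k * (x (vs ! i))\<^sup>2)"
      using v(1) by (intro sum.cong refl) (simp add: v(3) xi power2_eq_square)
    also have "\<dots> = k * (\<Sum>u\<in>V. (x u)\<^sup>2)" by (simp add: reidx sum_distrib_left)
    finally have "k * (\<Sum>u\<in>V. (x u)\<^sup>2) \<le> l * (\<Sum>u\<in>V. (x u)\<^sup>2)"
      using adj.adj_form_le_top[OF fV, of x] by (simp add: l_def)
    moreover have "(\<Sum>u\<in>V. (x u)\<^sup>2) > 0"
    proof -
      obtain i where i: "i < n" "v $ i \<noteq> 0" using v(1,2) by (metis carrier_vecD eq_vecI index_zero_vec)
      have "vs ! i \<in> V" using i vs by (auto simp: n_def)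
      then show ?thesis using i xi[OF i(1)] fV by (intro sum_pos2[of _ "vs ! i"]) auto
    qed
    ultimately show ?thesis by (simp only: mult_le_cancel_right_pos)
  qed
  ultimately have "Max (spectrum A) \<le> l" using card_finite_spectrum(1)[OF Ac] by (subst Max_le_iff) auto
  then show ?thesis by (simp add: graph_index_def A_def l_def V_def)
qed

section \<open>Induced subgraphs and joints\<close>

lemma arcs_ends_induce:
  "arcs_ends (G \<restriction> R) = {(u, v) \<in> arcs_ends G. u \<in> R \<and> v \<in> R}"
  by (auto simp: arcs_ends_def arc_to_ends_def)

lemma graph_induce: "R \<subseteq> verts G \<Longrightarrow> graph (G \<restriction> R)"
  by unfold_locales
     (use sym_arcs in \<open>auto simp: symmetric_def arcs_ends_induce sym_def no_loops intro: no_multi_arcs dest: finite_subset\<close>)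

lemma complete_induce_clique:
  assumes "R \<in> adj.cliques (verts G) k"
  shows "complete_digraph k (G \<restriction> R)"
  using assms graph_induce[of R] adj.irrefl
  by (auto simp: complete_digraph_def adj.cliques_def arcs_ends_induce pairwise_def)

text \<open>The point is that the \<open>Max\<close> is over a finite set: the cliques of a joint
  are subgraphs of \<open>G\<close>, with its \<open>tail\<close> and \<open>head\<close>, hence
  determined by subsets of \<open>verts G\<close> and \<open>arcs G\<close>.\<close>

lemma joint_size_ge:
  assumes "subgraph J G" "is_joint k t J"
  shows "t \<le> joint_size k G"
proof -
  define S where "S = {H :: ('a, 'b) pre_digraph. verts H \<subseteq> verts G \<and> arcs H \<subseteq> arcs G \<and> tail H = tail G \<and> head H = head G}"
  have "S \<subseteq> (\<lambda>(V, A). \<lparr>verts = V, arcs = A, tail = tail G, head = head G\<rparr>) ` (Pow (verts G) \<times> Pow (arcs G))"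
  proof
    fix H assume "H \<in> S"
    then show "H \<in> (\<lambda>(V, A). \<lparr>verts = V, arcs = A, tail = tail G, head = head G\<rparr>) ` (Pow (verts G) \<times> Pow (arcs G))"
      by (intro image_eqI[of _ _ "(verts H, arcs H)"]) (auto simp: S_def)
  qed
  then have fS: "finite S" by (rule finite_subset) simp
  have bound: "t \<le> card S" if "subgraph J G" "is_joint k t J" for t J
  proof -
    from that(2) obtain C where C: "card C = t" "\<forall>H\<in>C. subgraph H J \<and> complete_digraph k H"
      unfolding is_joint_def by (elim conjE exE)
    have "C \<subseteq> S"
    proof
      fix H assume "H \<in> C"
      then have "subgraph H J" using C by auto
      then show "H \<in> S" using that(1) by (auto simp: S_def subgraph_def compatible_def)
    qed
    then show ?thesis using card_mono[OF fS, of C] C(1) by simp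
  qed
  let ?T = "{t. \<exists>J. subgraph J G \<and> is_joint k t J}"
  have "?T \<subseteq> {..card S}"
  proof
    fix t assume "t \<in> ?T"
    then obtain J where "subgraph J G" "is_joint k t J" by (elim CollectE exE conjE)
    then show "t \<in> {..card S}" using bound[of J t] by simp
  qed
  then have "finite ?T" by (rule finite_subset) simp
  moreover have "t \<in> ?T" by (intro CollectI exI[of _ J] conjI assms)
  ultimately show ?thesis unfolding joint_size_def by (rule Max_ge)
qed

text \<open>The union of all induced \<open>k\<close>-cliques containing \<open>u\<close> and
  \<open>v\<close> is a joint with an arc from \<open>u\<close> to \<open>v\<close> as common edge.
  If there are none, it is the empty graph, a joint of size 0.\<close>

lemma edge_cliques_le_joint_size:
  "adj.edge_cliques_le (verts G) k (real (joint_size k G))"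
  unfolding adj.edge_cliques_le_def
proof (intro ballI impI)
  fix u v assume uv: "u \<in> verts G" "v \<in> verts G" "(u, v) \<in> arcs_ends G"
  define \<R> where "\<R> = {R \<in> adj.cliques (verts G) k. u \<in> R \<and> v \<in> R}"
  define C where "C = (\<lambda>R. G \<restriction> R) ` \<R>"
  define J where "J = \<lparr>verts = (\<Union>H\<in>C. verts H), arcs = (\<Union>H\<in>C. arcs H), tail = tail G, head = head G\<rparr>"
  have fR: "finite \<R>" by (simp add: \<R>_def)
  have sub: "R \<subseteq> verts G" if "R \<in> \<R>" for R using that by (auto simp: \<R>_def adj.cliques_def)
  have vJ: "verts J = \<Union>\<R>" by (simp add: J_def C_def)
  have aJ: "arcs J = (\<Union>R\<in>\<R>. arcs (G \<restriction> R))" by (simp add: J_def C_def)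
  have tJ: "tail J = tail G" "head J = head G" by (auto simp: J_def)
  have JG: "verts J \<subseteq> verts G" "arcs J \<subseteq> arcs G" using sub by (auto simp: vJ aJ)
  have wfJ: "wf_digraph J" by unfold_locales (auto simp: vJ aJ tJ)
  have endsJ: "arcs_ends J = (\<Union>R\<in>\<R>. arcs_ends (G \<restriction> R))"
    by (auto simp: arcs_ends_def aJ arc_to_ends_def tJ)
  have gJ: "graph J"
  proof -
    interpret J: wf_digraph J by (rule wfJ)
    show ?thesis
    proof unfold_locales
      show "finite (verts J)" "finite (arcs J)" using JG finite_subset by (auto intro: finite_subset)
      show "symmetric J"
        using adj.sym by (auto simp: symmetric_def endsJ arcs_ends_induce sym_def)
    next
      fix e assume "e \<in> arcs J"
      then show "tail J e \<noteq> head J e" using no_loops JG(2) by (auto simp: tJ)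
    next
      fix e1 e2 assume "e1 \<in> arcs J" "e2 \<in> arcs J" "arc_to_ends J e1 = arc_to_ends J e2"
      then show "e1 = e2" using JG(2) by (intro no_multi_arcs) (auto simp: arc_to_ends_def tJ)
    qed
  qed
  have "subgraph J G" using JG wfJ wf_digraph by (auto simp: subgraph_def compatible_def tJ)
  moreover have "is_joint k (card \<R>) J"
    unfolding is_joint_def
  proof (intro conjI exI[of _ C] ballI gJ)
    show "finite C" using fR by (simp add: C_def)
    have "inj_on (\<lambda>R. G \<restriction> R) \<R>"
      by (rule inj_on_inverseI[where g = verts]) simp
    then show "card C = card \<R>" by (simp add: C_def card_image)
    obtain e where e: "e \<in> arcs G" "tail G e = u" "head G e = v"
      using uv(3) by (auto simp: arcs_ends_def arc_to_ends_def)
    show "\<exists>e. \<forall>H\<in>C. e \<in> arcs H" using e by (intro exI[of _ e]) (auto simp: C_def \<R>_def)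
    show "verts J = (\<Union>H\<in>C. verts H)" "arcs J = (\<Union>H\<in>C. arcs H)" by (auto simp: J_def)
    fix H assume "H \<in> C"
    then obtain R where R: "R \<in> \<R>" "H = G \<restriction> R" by (auto simp: C_def)
    show "complete_digraph k H" using R complete_induce_clique by (auto simp: \<R>_def)
    show "subgraph H J"
      using R wfJ wellformed_induce_subgraph[of R] by (auto simp: subgraph_def compatible_def vJ aJ tJ)
  qed
  ultimately have "card \<R> \<le> joint_size k G" by (rule joint_size_ge)
  then show "real (card {R \<in> adj.cliques (verts G) k. u \<in> R \<and> v \<in> R}) \<le> real (joint_size k G)"
    by (simp add: \<R>_def)
qed

text \<open>The absence of parallel arcs makes \<open>head G\<close> injective on the arcs leaving
  \<open>u\<close>.\<close>

lemma out_degree_induce: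
  assumes "u \<in> U" "U \<subseteq> verts G"
  shows "out_degree (G \<restriction> U) u = card (adj.nbrs U u)"
proof -
  have "bij_betw (head G) (out_arcs (G \<restriction> U) u) (adj.nbrs U u)"
  proof (rule bij_betw_imageI)
    show "inj_on (head G) (out_arcs (G \<restriction> U) u)"
      by (rule inj_onI) (auto intro: no_multi_arcs simp: arc_to_ends_def)
    show "head G ` out_arcs (G \<restriction> U) u = adj.nbrs U u"
      unfolding adj.nbrs_def using assms by (force simp: arcs_ends_def arc_to_ends_def)
  qed
  then show ?thesis by (simp add: out_degree_def bij_betw_same_card)
qed

end

theorem theorem4:
  fixes r n :: nat and b :: real and G :: "('a, 'b) pre_digraph"
  assumes "r \<ge> 2"
    and "0 < b" and "b < 1 / (2 ^ 10 * real r ^ 6)"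
    and "n \<ge> r ^ 20"
    and "graph G" and "card (verts G) = n"
    and "graph_index G > (1 - 1 / real r - b) * real n"
  shows "real (joint_size (r + 1) G) > real n ^ (r - 1) / real r ^ (2 * r + 5) \<or>
    (\<exists>G0. induced_subgraph G0 G \<and> multipartite r G0 \<and>
       real (card (verts G0)) \<ge> (1 - 4 * b powr (1 / 3)) * real n \<and>
       real (min_degree G0) > (1 - 1 / real r - 7 * b powr (1 / 3)) * real n)"
proof (rule disjCI)
  assume small: "\<not> (\<exists>G0. induced_subgraph G0 G \<and> multipartite r G0 \<and>
       real (card (verts G0)) \<ge> (1 - 4 * b powr (1 / 3)) * real n \<and>
       real (min_degree G0) > (1 - 1 / real r - 7 * b powr (1 / 3)) * real n)"
  interpret graph G by fact
  have "n > 0" using assms(1,4) by (metis gr0I le_zero_eq not_numeral_le_zero power_eq_0_iff)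
  then have "verts G \<noteq> {}" using assms(6) by auto
  then have top: "adj.top_eigenvalue (verts G) \<ge> (1 - 1 / real r - b) * real n"
    using graph_index_le_top_eigenvalue assms(7) by linarith
  show "real (joint_size (r + 1) G) > real n ^ (r - 1) / real r ^ (2 * r + 5)"
  proof (rule ccontr)
    assume "\<not> ?thesis"
    then have "adj.edge_cliques_le (verts G) (Suc r) (real n ^ (r - 1) / real r ^ (2 * r + 5))"
      using edge_cliques_le_joint_size[of "Suc r"] unfolding adj.edge_cliques_le_def by fastforce
    then obtain U c where U: "U \<subseteq> verts G" "U \<noteq> {}"
        "real (card U) \<ge> (1 - 4 * b powr (1 / 3)) * real n"
        "\<forall>u\<in>U. real (card (adj.nbrs U u)) > (1 - 1 / real r - 7 * b powr (1 / 3)) * real n"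
      and c: "\<forall>u\<in>U. c u < r" "\<forall>u\<in>U. \<forall>v\<in>U. (u, v) \<in> arcs_ends G \<longrightarrow> c u \<noteq> (c v :: nat)"
      using adj.spectral_stability[OF finite_verts assms(6,1,2,3,4) top] by blast
    have fU: "finite U" by (rule finite_subset[OF U(1) finite_verts])
    have "induced_subgraph (G \<restriction> U) G" using U(1) by auto
    moreover have "multipartite r (G \<restriction> U)"
      unfolding multipartite_def
    proof (intro exI[of _ "\<lambda>i. {u\<in>U. c u = i}"] conjI allI impI)
      show "disjoint_family_on (\<lambda>i. {u\<in>U. c u = i}) {..<r}" by (auto simp: disjoint_family_on_def)
      show "(\<Union>i<r. {u\<in>U. c u = i}) = verts (G \<restriction> U)" using c(1) by auto
      show "independent_in (G \<restriction> U) {u\<in>U. c u = i}" for i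
        unfolding independent_in_def arcs_ends_induce using c(2) by fastforce
    qed
    moreover have "real (min_degree (G \<restriction> U)) > (1 - 1 / real r - 7 * b powr (1 / 3)) * real n"
    proof -
      have "min_degree (G \<restriction> U) \<in> out_degree (G \<restriction> U) ` U"
        unfolding min_degree_def using fU U(2) by (simp add: Min_in)
      then show ?thesis using U(1,4) out_degree_induce by auto
    qed
    ultimately show False using small U(3) by auto
  qed
qed

end
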